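(* Let $\{Z,Z_i,\ i\ge1\}$ be i.i.d. random vectors in $\mathbb R^d$, with $Z=(Z^{(1)},\dots,Z^{(d)})$. Suppose that for all $j\ne k$, $$E|Z^{(j)}Z^{(k)}|<\infty\quad\text{whenever}\quad E(Z^{(j)})^2=\infty\ \text{ and/or }\ E(Z^{(k)})^2=\infty .$$ Let $\widetilde Z$ be the vector formed by all the components of $Z$, if any, whose second moments are finite, and assume that $\widetilde Z$ is full. Then the following two statements are equivalent: (a) $Z\in\mathrm{GDAN}$; (b) $Z^{(j)}\in\mathrm{DAN}$ for all $1\le j\le d$.
   Context: All vectors are row vectors. A random vector $W$ is full if $\langle W,u\rangle$ is a nondegenerate random variable for every deterministic vector $u$ of unit Euclidean norm (if no component of $Z$ has a finite second moment, the fullness requirement on $\widetilde Z$ is void). DAN (domain of attraction of the normal law): a random variable $X$ is in DAN if, for i.i.d. copies $X_i$ of $X$, there are constants $a_n$ and $b_n>0$ with $(\sum_{i=1}^nX_i-a_n)b_n^{-1}\xrightarrow{\mathcal D}N(0,1)$ as $n\to\infty$. GDAN (generalized domain of attraction of the $d$-variate normal law): a random vector $Z$ in $\mathbb R^d$ is in GDAN if, for i.i.d. copies $Z_i$ of $Z$, there exist nonstochastic vectors $a_n$ and nonstochastic $d\times d$ matrices $B_n$ such that $\big(\sum_{i=1}^nZ_i-a_n\big)B_n^T\xrightarrow{\mathcal D}N(0,I_d)$ as $n\to\infty$. *)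

theory Defs
  imports "HOL-Probability.Probability"
begin

text \<open>
  The joint law of an i.i.d. sequence of copies of \<open>X\<close>, realised on the infinite product space,
  where the \<open>i\<close>-th copy is the \<open>i\<close>-th coordinate. Both domains of attraction depend only on this
  law; by \<open>joint_law_eq_iid_law\<close> it is the law of every i.i.d. sequence of copies of \<open>X\<close>, on
  whatever probability space the sequence is defined.
\<close>

definition iid_law :: "'a measure \<Rightarrow> ('a \<Rightarrow> 'b::topological_space) \<Rightarrow> (nat \<Rightarrow> 'b) measure" where
  "iid_law M X = PiM UNIV (\<lambda>_. distr M borel X)"

lemma joint_law_eq_iid_law:
  fixes X :: "'a \<Rightarrow> 'b::topological_space" and Xs :: "nat \<Rightarrow> 'c \<Rightarrow> 'b"
  assumes "prob_space N" and "prob_space.indep_vars N (\<lambda>_. borel) Xs UNIV"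
    and law: "\<And>i. distr N borel (Xs i) = distr M borel X"
  shows "distr N (PiM UNIV (\<lambda>_. borel)) (\<lambda>\<omega> i. Xs i \<omega>) = iid_law M X"
proof -
  interpret prob_space N by fact
  have rv: "random_variable borel (Xs i)" for i
    using assms(2) by (auto simp: indep_vars_def)
  have "distr N (PiM UNIV (\<lambda>_. borel)) (\<lambda>\<omega>. \<lambda>i\<in>UNIV. Xs i \<omega>) = PiM UNIV (\<lambda>i. distr N borel (Xs i))"
    using assms(2) by (subst (asm) indep_vars_iff_distr_eq_PiM'[OF _ rv]) auto
  then show ?thesis by (simp add: law iid_law_def restrict_def)
qed

definition DAN :: "'a measure \<Rightarrow> ('a \<Rightarrow> real) \<Rightarrow> bool" where
  "DAN M X \<longleftrightarrow> (\<exists>(a :: nat \<Rightarrow> real) (b :: nat \<Rightarrow> real). (\<forall>n. 0 < b n) \<and>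
     weak_conv_m
       (\<lambda>n. distr (iid_law M X) borel (\<lambda>\<omega>. ((\<Sum>i<n. \<omega> i) - a n) * inverse (b n)))
       std_normal_distribution)"

text \<open>
  The library's \<open>weak_conv_m\<close> is restricted to laws on the real line.
\<close>

definition weak_conv_vec ::
    "(nat \<Rightarrow> (real ^ 'd) measure) \<Rightarrow> (real ^ 'd) measure \<Rightarrow> bool" where
  "weak_conv_vec Ms L \<longleftrightarrow>
     (\<forall>f :: real ^ 'd \<Rightarrow> real. continuous_on UNIV f \<and> bounded (range f) \<longrightarrow>
        (\<lambda>n. \<integral>x. f x \<partial>(Ms n)) \<longlonglongrightarrow> (\<integral>x. f x \<partial>L))"

definition std_normal_vec :: "(real ^ 'd) measure" where
  "std_normal_vec = density lborel (\<lambda>x. ennreal (\<Prod>j\<in>UNIV. std_normal_density (x $ j)))"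

definition GDAN :: "'a measure \<Rightarrow> ('a \<Rightarrow> real ^ 'd) \<Rightarrow> bool" where
  "GDAN M Z \<longleftrightarrow> (\<exists>(a :: nat \<Rightarrow> real ^ 'd) (B :: nat \<Rightarrow> real ^ 'd ^ 'd).
     weak_conv_vec
       (\<lambda>n. distr (iid_law M Z) borel (\<lambda>\<omega>. ((\<Sum>i<n. \<omega> i) - a n) v* transpose (B n)))
       std_normal_vec)"

definition degenerate :: "'a measure \<Rightarrow> ('a \<Rightarrow> real) \<Rightarrow> bool" where
  "degenerate M X \<longleftrightarrow> (\<exists>c. AE \<omega> in M. X \<omega> = c)"

text \<open>
  Fullness of a random vector whose components \<open>W \<omega> j\<close> are indexed by a finite set \<open>J\<close>, so that
  it applies to a subvector of a given vector. For \<open>J = {}\<close> there is no unit vector and the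
  condition is void.
\<close>

definition full :: "'a measure \<Rightarrow> 'i set \<Rightarrow> ('a \<Rightarrow> 'i \<Rightarrow> real) \<Rightarrow> bool" where
  "full M J W \<longleftrightarrow>
     (\<forall>u :: 'i \<Rightarrow> real. L2_set u J = 1 \<longrightarrow> \<not> degenerate M (\<lambda>\<omega>. \<Sum>j\<in>J. W \<omega> j * u j))"

definition second_moment :: "'a measure \<Rightarrow> ('a \<Rightarrow> real) \<Rightarrow> ennreal" where
  "second_moment M X = (\<integral>\<^sup>+ \<omega>. ennreal ((X \<omega>)\<^sup>2) \<partial>M)"

end

theory Submission
  imports Defs
begin

text \<open>
  Both domains of attraction are read off from characteristic functions, through Levy's continuity
  theorem on the line and in \<open>real ^ 'd\<close>.

  If \<open>(S n - a n) v* transpose (B n)\<close> is asymptotically standard normal, choose unit vectors \<open>u n\<close>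
  such that \<open>u n v* B n\<close> is a positive multiple of the \<open>j\<close>-th axis. Convergence of characteristic
  functions is locally uniform and the unit sphere is compact, so the projections on \<open>u n\<close>, which are
  normalisations of the \<open>j\<close>-th coordinate, are asymptotically standard normal as well.

  Conversely, normalise each coordinate with infinite variance by the constants \<open>b n\<close> of its own
  domain of attraction and the others by \<open>sqrt n\<close>. Infinite variance forces \<open>b n / sqrt n\<close> to
  infinity and \<open>E |cis (s X / b n) - 1| = o(1 / sqrt n)\<close>. With \<open>E |Z j Z k| < \<infinity>\<close> this makes the
  covariances of the factors of \<open>cis (t \<bullet> Z)\<close> of order \<open>o(1 / n)\<close>, so in the limit the characteristic
  function is the product of those of the coordinates with infinite variance and that of the block
  with finite variances. The block obeys the classical central limit theorem, and its covariance
  form, nondegenerate by fullness, is reduced to the identity by an orthonormal basis.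
\<close>

subsection \<open>Characteristic functions of laws on Euclidean spaces\<close>

text \<open>The size of the error in the converse is dictated by the exponent \<open>n\<close>: in
  the unit disc \<open>|x^n - y^n| \<le> n |x - y|\<close>, so a characteristic function may be
  replaced by a factorised one if the two differ by \<open>o(1 / n)\<close>. For two coordinates,
  the mean product of the distances of their \<open>cis\<close> factors from 1 is at most a constant
  times the product of the inverse norming constants. This is \<open>o(1 / n)\<close> as soon as one
  of the two constants grows faster than \<open>sqrt n\<close>, but only \<open>O(1 / n)\<close>
  when both are \<open>sqrt n\<close>. Correlations inside the block of finite variances therefore
  survive in the limit: the block is kept whole, and fullness is a condition on it alone. To obtain
  all rows of \<open>B n\<close> from a single basis, the covariance form of the block is extended
  by the identity on the remaining coordinates. In the forward direction the obstacle is that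
  nothing is known about \<open>B n\<close>, which may even be singular; such \<open>n\<close> are
  excluded afterwards, because there a projection of the normalised sum would be constant.\<close>

definition mchar :: "'e::euclidean_space measure \<Rightarrow> 'e \<Rightarrow> complex" where
  "mchar L t = (\<integral>x. cis (t \<bullet> x) \<partial>L)"

definition borel_prob :: "'e::euclidean_space measure \<Rightarrow> bool" where
  "borel_prob L \<longleftrightarrow> prob_space L \<and> sets L = sets borel"

lemma borel_prob_distr:
  fixes X :: "'a \<Rightarrow> 'e::euclidean_space"
  shows "prob_space M \<Longrightarrow> X \<in> borel_measurable M \<Longrightarrow> borel_prob (distr M borel X)"
  by (simp add: borel_prob_def prob_space.prob_space_distr)

lemma borel_prob_imp_real_distribution:
  "borel_prob L \<Longrightarrow> real_distribution L"
  by (simp add: borel_prob_def real_distribution_def real_distribution_axioms_def)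

lemma borel_measurable_cis [measurable]: "cis \<in> borel_measurable borel"
  by (intro borel_measurable_continuous_onI continuous_intros)

lemma (in prob_space) integrable_cis:
  assumes [measurable]: "f \<in> borel_measurable M"
  shows "integrable M (\<lambda>x. cis (f x))"
  by (rule integrable_const_bound[where B=1]) auto

lemma char_eq_mchar: "char L t = mchar L t"
  by (simp add: char_def mchar_def cis_conv_exp)

lemma mchar_distr:
  fixes X :: "'a \<Rightarrow> 'e::euclidean_space"
  assumes [measurable]: "X \<in> borel_measurable M"
  shows "mchar (distr M borel X) t = (\<integral>\<omega>. cis (t \<bullet> X \<omega>) \<partial>M)"
  unfolding mchar_def by (subst integral_distr) auto

lemma norm_mchar_le_1:
  assumes "borel_prob L"
  shows "norm (mchar L t) \<le> 1"
proof -
  interpret prob_space L using assms by (simp add: borel_prob_def)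
  have "norm (mchar L t) \<le> (\<integral>x. norm (cis (t \<bullet> x)) \<partial>L)"
    unfolding mchar_def by (rule integral_norm_bound)
  then show ?thesis by (simp add: prob_space)
qed

lemma mchar_zero: "borel_prob L \<Longrightarrow> mchar L 0 = 1"
  by (simp add: mchar_def borel_prob_def prob_space.prob_space)

lemma norm_cis_diff_le: "norm (cis a - cis b) \<le> \<bar>a - b\<bar>"
proof -
  have "cis a - cis b = cis b * (cis (a - b) - 1)"
    by (simp add: algebra_simps cis_mult)
  then have "norm (cis a - cis b) = norm (cis (a - b) - 1)"
    by (simp add: norm_mult)
  also have "\<dots> \<le> \<bar>a - b\<bar>"
    using iexp_approx1[of "a - b" 0] by (simp add: cis_conv_exp)
  finally show ?thesis .
qed

lemma norm_cis_diff_le_2: "norm (cis a - cis b) \<le> 2"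
  using norm_triangle_ineq4[of "cis a" "cis b"] by simp

text \<open>Equicontinuity: \<open>min 2 (\<delta> * norm x)\<close> dominates the change of
  \<open>cis\<close> when its argument moves by at most \<delta>. The integral of this function
  under \<nu> is small for small \<delta>, and since it is bounded and continuous the smallness
  carries over to \<open>\<mu> n\<close> for large \<open>n\<close>. Convergence is assumed on test
  functions, a form that fits laws on the line as well as in \<open>real ^ 'd\<close>.\<close>

lemma mchar_uniform_tendsto:
  fixes \<mu> :: "nat \<Rightarrow> 'e::euclidean_space measure"
  assumes \<mu>: "\<And>n. borel_prob (\<mu> n)" and \<nu>: "borel_prob \<nu>"
    and conv: "\<And>f::'e \<Rightarrow> real. continuous_on UNIV f \<Longrightarrow> bounded (range f) \<Longrightarrow>
      (\<lambda>n. \<integral>x. f x \<partial>\<mu> n) \<longlonglongrightarrow> (\<integral>x. f x \<partial>\<nu>)"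
    and u: "u \<longlonglongrightarrow> u0"
  shows "(\<lambda>n. mchar (\<mu> n) (u n)) \<longlonglongrightarrow> mchar \<nu> u0"
proof -
  have sets_\<mu> [measurable_cong]: "sets (\<mu> n) = sets borel" for n
    using \<mu> by (simp add: borel_prob_def)
  have sets_\<nu> [measurable_cong]: "sets \<nu> = sets borel"
    using \<nu> by (simp add: borel_prob_def)
  interpret \<mu>: prob_space "\<mu> n" for n using \<mu> by (simp add: borel_prob_def)
  interpret \<nu>: prob_space \<nu> using \<nu> by (simp add: borel_prob_def)
  have int_\<mu>: "integrable (\<mu> n) (\<lambda>x. cis (t \<bullet> x))" for n t
    by (rule \<mu>.integrable_cis) simp
  have int_\<nu>: "integrable \<nu> (\<lambda>x. cis (t \<bullet> x))" for t
    by (rule \<nu>.integrable_cis) simp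
  have pt: "(\<lambda>n. mchar (\<mu> n) t) \<longlonglongrightarrow> mchar \<nu> t" for t
    unfolding tendsto_complex_iff mchar_def
      integral_Re[OF int_\<mu>, symmetric] integral_Im[OF int_\<mu>, symmetric]
      integral_Re[OF int_\<nu>, symmetric] integral_Im[OF int_\<nu>, symmetric]
    by (intro conjI conv)
       (auto intro!: continuous_intros boundedI[where B=1])
  have "(\<lambda>n. mchar (\<mu> n) (u n) - mchar (\<mu> n) u0) \<longlonglongrightarrow> 0"
  proof (rule LIMSEQ_I)
    fix \<epsilon> :: real assume "\<epsilon> > 0"
    have "(\<lambda>k. \<integral>x. min 2 (inverse (real (Suc k)) * norm x) \<partial>\<nu>) \<longlonglongrightarrow> (\<integral>x. 0 \<partial>\<nu>)"
    proof (rule integral_dominated_convergence[where w="\<lambda>_. 2"])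
      show "AE x in \<nu>. (\<lambda>k. min 2 (inverse (real (Suc k)) * norm x)) \<longlonglongrightarrow> 0"
      proof (rule AE_I2)
        fix x
        have "(\<lambda>k. min 2 (inverse (real (Suc k)) * norm x)) \<longlonglongrightarrow> min 2 (0 * norm x)"
          by (intro tendsto_intros LIMSEQ_inverse_real_of_nat)
        then show "(\<lambda>k. min 2 (inverse (real (Suc k)) * norm x)) \<longlonglongrightarrow> 0" by simp
      qed
    qed auto
    then have "eventually (\<lambda>k. (\<integral>x. min 2 (inverse (real (Suc k)) * norm x) \<partial>\<nu>) < \<epsilon>) sequentially"
      using \<open>\<epsilon> > 0\<close> by (auto dest!: order_tendstoD(2))
    then obtain k where k: "(\<integral>x. min 2 (inverse (real (Suc k)) * norm x) \<partial>\<nu>) < \<epsilon>"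
      by (auto simp: eventually_sequentially)
    define \<delta> where "\<delta> = inverse (real (Suc k))"
    have \<delta>: "\<delta> > 0" "(\<integral>x. min 2 (\<delta> * norm x) \<partial>\<nu>) < \<epsilon>"
      using k by (simp_all add: \<delta>_def)
    have "(\<lambda>n. \<integral>x. min 2 (\<delta> * norm x) \<partial>\<mu> n) \<longlonglongrightarrow> (\<integral>x. min 2 (\<delta> * norm x) \<partial>\<nu>)"
      using \<delta>(1) by (intro conv continuous_intros boundedI[where B=2]) auto
    from order_tendstoD(2)[OF this \<delta>(2)]
    have "eventually (\<lambda>n. (\<integral>x. min 2 (\<delta> * norm x) \<partial>\<mu> n) < \<epsilon>) sequentially" .
    moreover have "eventually (\<lambda>n. norm (u n - u0) < \<delta>) sequentially"
      using tendstoD[OF u \<delta>(1)] by (simp add: dist_norm)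
    ultimately have "eventually (\<lambda>n. norm (mchar (\<mu> n) (u n) - mchar (\<mu> n) u0 - 0) < \<epsilon>) sequentially"
    proof eventually_elim
      case (elim n)
      have "norm (mchar (\<mu> n) (u n) - mchar (\<mu> n) u0) = norm (\<integral>x. cis (u n \<bullet> x) - cis (u0 \<bullet> x) \<partial>\<mu> n)"
        by (simp add: mchar_def int_\<mu>)
      also have "\<dots> \<le> (\<integral>x. norm (cis (u n \<bullet> x) - cis (u0 \<bullet> x)) \<partial>\<mu> n)"
        by (rule integral_norm_bound)
      also have "\<dots> \<le> (\<integral>x. min 2 (\<delta> * norm x) \<partial>\<mu> n)"
      proof (rule integral_mono)
        show "integrable (\<mu> n) (\<lambda>x. norm (cis (u n \<bullet> x) - cis (u0 \<bullet> x)))"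
          by (intro integrable_norm Bochner_Integration.integrable_diff int_\<mu>)
        show "integrable (\<mu> n) (\<lambda>x. min 2 (\<delta> * norm x))"
          using \<delta>(1) by (intro \<mu>.integrable_const_bound[where B=2]) auto
        fix x
        have "norm (cis (u n \<bullet> x) - cis (u0 \<bullet> x)) \<le> \<bar>u n \<bullet> x - u0 \<bullet> x\<bar>"
          by (rule norm_cis_diff_le)
        also have "\<dots> = \<bar>(u n - u0) \<bullet> x\<bar>" by (simp add: inner_diff_left)
        also have "\<dots> \<le> norm (u n - u0) * norm x" by (rule Cauchy_Schwarz_ineq2)
        also have "\<dots> \<le> \<delta> * norm x" using elim(2) by (intro mult_right_mono) auto
        finally show "norm (cis (u n \<bullet> x) - cis (u0 \<bullet> x)) \<le> min 2 (\<delta> * norm x)"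
          using norm_cis_diff_le_2 by simp
      qed
      finally show ?case using elim(1) by simp
    qed
    then show "\<exists>no. \<forall>n\<ge>no. norm (mchar (\<mu> n) (u n) - mchar (\<mu> n) u0 - 0) < \<epsilon>"
      by (simp add: eventually_sequentially)
  qed
  from tendsto_add[OF this pt[of u0]] show ?thesis by simp
qed

section \<open>Characteristic functions of sums of independent copies\<close>

lemma prob_space_iid_law:
  assumes "prob_space M" "X \<in> borel_measurable M"
  shows "prob_space (iid_law M X)"
  unfolding iid_law_def using assms by (intro prob_space_PiM prob_space.prob_space_distr)

lemma sets_iid_law [measurable_cong]: "sets (iid_law M X) = sets (PiM UNIV (\<lambda>_. borel))"
  unfolding iid_law_def by (rule sets_PiM_cong) auto

lemma iid_law_integral_prod:
  fixes X :: "'a \<Rightarrow> 'e::euclidean_space" and f :: "'e \<Rightarrow> complex"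
  assumes M: "prob_space M" and X [measurable]: "X \<in> borel_measurable M"
    and f [measurable]: "f \<in> borel_measurable borel" and bd: "\<And>x. norm (f x) \<le> B"
  shows "(\<integral>\<omega>. (\<Prod>i<n. f (\<omega> i)) \<partial>iid_law M X) = (\<integral>\<omega>. f (X \<omega>) \<partial>M) ^ n"
proof -
  interpret M: prob_space M by fact
  interpret L: prob_space "iid_law M X" using assms by (intro prob_space_iid_law)
  interpret D: prob_space "distr M borel X" by (rule M.prob_space_distr) simp
  interpret P: product_prob_space "\<lambda>_::nat. distr M borel X" UNIV
    by unfold_locales
  have law: "distr (iid_law M X) borel (\<lambda>\<omega>. \<omega> i) = distr M borel X" for i
    using P.PiM_component[of i] unfolding iid_law_def by (simp cong: distr_cong)
  have rv: "L.random_variable borel (\<lambda>\<omega>. \<omega> i)" for i by measurable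
  have "L.indep_vars (\<lambda>_. borel) (\<lambda>i \<omega>. \<omega> i) UNIV"
  proof (subst L.indep_vars_iff_distr_eq_PiM[OF _ rv])
    \<comment> \<open>All coordinates together form the identity map, so their joint law is the
      product measure itself; this is the criterion for independence.\<close>
    have "distr (iid_law M X) (PiM UNIV (\<lambda>_. borel)) (\<lambda>x. \<lambda>i\<in>UNIV. x i) = distr (iid_law M X) (iid_law M X) (\<lambda>x. x)"
      by (rule distr_cong) (auto simp: sets_iid_law)
    also have "\<dots> = iid_law M X" by (simp add: distr_id2)
    finally show "distr (iid_law M X) (PiM UNIV (\<lambda>_. borel)) (\<lambda>x. \<lambda>i\<in>UNIV. x i) =
      PiM UNIV (\<lambda>i. distr (iid_law M X) borel (\<lambda>\<omega>. \<omega> i))"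
      by (simp only: law) (simp add: iid_law_def)
  qed auto
  then have "L.indep_vars (\<lambda>_. borel) (\<lambda>i \<omega>. \<omega> i) {..<n}"
    by (rule L.indep_vars_subset) auto
  then have ind: "L.indep_vars (\<lambda>_. borel) (\<lambda>i \<omega>. f (\<omega> i)) {..<n}"
    by (rule L.indep_vars_compose2) auto
  have int: "integrable (iid_law M X) (\<lambda>\<omega>. f (\<omega> i))" for i
    by (rule L.integrable_const_bound[where B=B]) (auto simp: bd)
  have coord: "(\<integral>\<omega>. f (\<omega> i) \<partial>iid_law M X) = (\<integral>\<omega>. f (X \<omega>) \<partial>M)" for i
  proof -
    have "(\<integral>\<omega>. f (\<omega> i) \<partial>iid_law M X) = (\<integral>x. f x \<partial>distr (iid_law M X) borel (\<lambda>\<omega>. \<omega> i))"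
      by (subst integral_distr) auto
    also have "\<dots> = (\<integral>\<omega>. f (X \<omega>) \<partial>M)"
      unfolding law by (subst integral_distr) auto
    finally show ?thesis .
  qed
  have "(\<integral>\<omega>. (\<Prod>i<n. f (\<omega> i)) \<partial>iid_law M X) = (\<Prod>i<n. \<integral>\<omega>. f (\<omega> i) \<partial>iid_law M X)"
    using ind int by (intro L.indep_vars_lebesgue_integral) auto
  then show ?thesis by (simp add: coord)
qed

text \<open>The centre enters only through a phase of modulus one and so disappears whenever moduli
  are taken.\<close>

lemma mchar_iid_sum:
  fixes X :: "'a \<Rightarrow> 'e::euclidean_space"
  assumes M: "prob_space M" and X [measurable]: "X \<in> borel_measurable M"
  shows "(\<integral>\<omega>. cis (t \<bullet> ((\<Sum>i<n. \<omega> i) - a)) \<partial>iid_law M X) =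
    cis (- (t \<bullet> a)) * mchar (distr M borel X) t ^ n"
proof -
  have "cis (t \<bullet> ((\<Sum>i<n. \<omega> i) - a)) = cis (- (t \<bullet> a)) * (\<Prod>i<n. cis (t \<bullet> \<omega> i))" for \<omega> :: "nat \<Rightarrow> 'e"
  proof -
    have "(\<Prod>i<n. cis (t \<bullet> \<omega> i)) = cis (\<Sum>i<n. t \<bullet> \<omega> i)"
      by (induction n) (auto simp: cis_mult add.commute)
    then show ?thesis by (simp add: cis_mult inner_diff_right inner_sum_right)
  qed
  then have "(\<integral>\<omega>. cis (t \<bullet> ((\<Sum>i<n. \<omega> i) - a)) \<partial>iid_law M X) =
    cis (- (t \<bullet> a)) * (\<integral>\<omega>. (\<Prod>i<n. cis (t \<bullet> \<omega> i)) \<partial>iid_law M X)"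
    by simp
  also have "(\<integral>\<omega>. (\<Prod>i<n. cis (t \<bullet> \<omega> i)) \<partial>iid_law M X) = (\<integral>\<omega>. cis (t \<bullet> X \<omega>) \<partial>M) ^ n"
    by (rule iid_law_integral_prod[OF M X, where B=1]) auto
  finally show ?thesis by (simp add: mchar_distr)
qed

section \<open>The standard normal vector\<close>

lemma borel_measurable_vec_nth [measurable]:
  "(\<lambda>x::real^'d. x $ j) \<in> borel_measurable borel"
  by (intro borel_measurable_continuous_onI continuous_intros)

lemma integral_PiM_lborel:
  fixes g :: "real ^ 'd \<Rightarrow> complex"
  assumes [measurable]: "g \<in> borel_measurable borel"
  shows "(\<integral>x. g x \<partial>lborel) = (\<integral>f. g (\<Sum>b\<in>Basis. f b *\<^sub>R b) \<partial>(\<Pi>\<^sub>M b\<in>Basis. lborel))"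
  by (subst lborel_eq) (subst integral_distr, auto)

lemma borel_prob_std_normal_vec: "borel_prob (std_normal_vec :: (real^'d) measure)"
proof -
  have "(\<integral>\<^sup>+x. (\<Prod>b\<in>Basis. ennreal (std_normal_density (x \<bullet> b))) \<partial>(lborel :: (real^'d) measure)) =
    (\<Prod>b\<in>(Basis::(real^'d) set). (\<integral>\<^sup>+x. ennreal (std_normal_density x) \<partial>lborel))"
    by (rule nn_integral_lborel_prod) auto
  also have "(\<integral>\<^sup>+x. ennreal (std_normal_density x) \<partial>lborel) = 1"
    using prob_space.emeasure_space_1[OF prob_space_normal_density[of 1 0]]
    by (simp add: emeasure_density)
  finally have "(\<integral>\<^sup>+x. (\<Prod>b\<in>Basis. ennreal (std_normal_density (x \<bullet> b))) \<partial>(lborel :: (real^'d) measure)) = 1"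
    by simp
  \<comment> \<open>The elements of \<open>Basis\<close> are the axes, one for each component, so
    the product is merely reindexed.\<close>
  moreover have "(\<Prod>b\<in>Basis. ennreal (std_normal_density (x \<bullet> b))) = ennreal (\<Prod>j\<in>UNIV. std_normal_density (x $ j))"
    for x :: "real^'d"
    by (subst prod_ennreal) (auto simp: Basis_vec_def axis_eq_axis inner_axis prod.reindex inj_on_def
        UNION_singleton_eq_range)
  ultimately show ?thesis
    unfolding borel_prob_def std_normal_vec_def
    by (auto intro!: prob_spaceI simp: emeasure_density)
qed

lemma mchar_std_normal_vec:
  "mchar (std_normal_vec :: (real^'d) measure) t = complex_of_real (exp (- (norm t)\<^sup>2 / 2))"
proof -
  let ?B = "Basis :: (real^'d) set"
  let ?f = "\<lambda>b x. cis ((t \<bullet> b) * x) * complex_of_real (std_normal_density x)"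
  interpret product_sigma_finite "\<lambda>_::real^'d. lborel :: real measure" ..
  have int: "integrable lborel (\<lambda>x. cis (s * x) * complex_of_real (std_normal_density x))" for s
  proof (rule Bochner_Integration.integrable_bound[OF integrable_std_normal_moment[of 0]])
    show "AE x in lborel. norm (cis (s * x) * complex_of_real (std_normal_density x)) \<le>
      norm (std_normal_density x * x ^ 0)"
      by (simp add: norm_mult)
  qed simp
  have one: "(\<integral>x. cis (s * x) * complex_of_real (std_normal_density x) \<partial>lborel) =
    complex_of_real (exp (- s\<^sup>2 / 2))" for s
  proof -
    have "complex_of_real (exp (- s\<^sup>2 / 2)) = char std_normal_distribution s"
      by (simp add: char_std_normal_distribution)
    also have "\<dots> = (\<integral>x. std_normal_density x *\<^sub>R cis (s * x) \<partial>lborel)"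
      unfolding char_def cis_conv_exp[symmetric] by (subst integral_density) auto
    finally show ?thesis by (simp add: scaleR_conv_of_real mult.commute)
  qed
  have comp: "(\<Sum>b\<in>?B. f b *\<^sub>R b) \<bullet> i = f i" if "i \<in> ?B" for f i
    using that by (simp add: inner_sum_left inner_Basis if_distrib sum.delta cong: if_cong)
  have dens: "(\<Prod>j\<in>UNIV. std_normal_density (x $ j)) = (\<Prod>b\<in>Basis. std_normal_density (x \<bullet> b))"
    for x :: "real^'d"
    by (auto simp: Basis_vec_def axis_eq_axis inner_axis prod.reindex inj_on_def
        UNION_singleton_eq_range)
  have cisprod: "cis (\<Sum>b\<in>A. g b) = (\<Prod>b\<in>A. cis (g b))" if "finite A" for A and g :: "real^'d \<Rightarrow> real"
    using that by induction (auto simp: cis_mult[symmetric])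
  have "mchar (std_normal_vec :: (real^'d) measure) t =
    (\<integral>x. cis (t \<bullet> x) * complex_of_real (\<Prod>j\<in>UNIV. std_normal_density (x $ j)) \<partial>lborel)"
    unfolding mchar_def std_normal_vec_def
    by (subst integral_density) (auto simp: scaleR_conv_of_real prod_nonneg mult.commute)
  also have "\<dots> = (\<integral>x. (\<Prod>b\<in>?B. ?f b (x \<bullet> b)) \<partial>lborel)"
    by (subst euclidean_inner) (simp add: dens cisprod prod.distrib)
  also have "\<dots> = (\<integral>f. (\<Prod>b\<in>?B. ?f b (f b)) \<partial>(\<Pi>\<^sub>M b\<in>?B. lborel))"
    by (subst integral_PiM_lborel) (auto simp: comp intro!: Bochner_Integration.integral_cong prod.cong)
  also have "\<dots> = (\<Prod>b\<in>?B. \<integral>x. ?f b x \<partial>lborel)"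
    by (rule product_integral_prod) (auto intro: int)
  also have "\<dots> = complex_of_real (exp (\<Sum>b\<in>?B. - (t \<bullet> b)\<^sup>2 / 2))"
    by (simp add: one exp_sum)
  also have "(\<Sum>b\<in>?B. - (t \<bullet> b)\<^sup>2 / 2) = - (norm t)\<^sup>2 / 2"
  proof -
    have "(norm t)\<^sup>2 = (\<Sum>b\<in>?B. (t \<bullet> b)\<^sup>2)"
      unfolding power2_norm_eq_inner by (subst euclidean_inner) (simp add: power2_eq_square)
    then show ?thesis by (simp add: sum_negf flip: sum_divide_distrib)
  qed
  finally show ?thesis .
qed

text \<open>Finite combinations of characters, whose integrals against a law are finite combinations
  of values of \<open>mchar\<close>. The inductive form lets convergence of these integrals be
  proved by induction from a single wave.\<close>

inductive trig_poly :: "('e::euclidean_space \<Rightarrow> complex) \<Rightarrow> bool" where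
  wave: "trig_poly (\<lambda>x. c * cis (t \<bullet> x))"
| add: "trig_poly f \<Longrightarrow> trig_poly g \<Longrightarrow> trig_poly (\<lambda>x. f x + g x)"

lemma trig_poly_const: "trig_poly (\<lambda>x. c)"
  using trig_poly.wave[of c 0] by simp

text \<open>A product of two characters is a character, so these functions form an algebra, into
  which polynomials can be substituted.\<close>

lemma trig_poly_mult:
  assumes "trig_poly f" "trig_poly g"
  shows "trig_poly (\<lambda>x. f x * g x)"
  using assms
proof (induction f)
  case (wave c t)
  from wave show ?case
  proof (induction g)
    case (wave d s)
    have "(\<lambda>x. c * cis (t \<bullet> x) * (d * cis (s \<bullet> x))) = (\<lambda>x. (c * d) * cis ((t + s) \<bullet> x))"
      by (simp add: cis_mult[symmetric] inner_add_left algebra_simps)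
    then show ?case by (simp only: trig_poly.wave)
  next
    case (add g h)
    then show ?case using trig_poly.add[OF add.IH] by (simp add: algebra_simps)
  qed
next
  case (add f h)
  then show ?case using trig_poly.add[OF add.IH] by (simp add: algebra_simps)
qed

lemma trig_poly_sum:
  "finite A \<Longrightarrow> (\<And>a. a \<in> A \<Longrightarrow> trig_poly (f a)) \<Longrightarrow> trig_poly (\<lambda>x. \<Sum>a\<in>A. f a x)"
  by (induction A rule: finite_induct) (simp_all add: trig_poly_const trig_poly.add)

lemma trig_poly_sin: "trig_poly (\<lambda>x. complex_of_real (sin (t \<bullet> x)))"
proof -
  have "complex_of_real (sin a) = (- \<i> / 2) * cis a + (\<i> / 2) * cis (- a)" for a
    by (simp add: complex_eq_iff)
  then have "(\<lambda>x. complex_of_real (sin (t \<bullet> x))) =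
    (\<lambda>x. (- \<i> / 2) * cis (t \<bullet> x) + (\<i> / 2) * cis ((- t) \<bullet> x))"
    by simp
  then show ?thesis by (simp only: trig_poly.wave trig_poly.add)
qed

text \<open>This turns the polynomials supplied by the Stone-Weierstrass theorem into functions
  controlled by \<open>mchar\<close>. The sine serves as the substitution because it combines two
  opposite characters and is invertible on \<open>[-pi/2, pi/2]\<close>.\<close>

lemma trig_poly_polynomial_sin:
  fixes p :: "real ^ 'd \<Rightarrow> real"
  assumes "real_polynomial_function p"
  shows "trig_poly (\<lambda>x :: real ^ 'd. complex_of_real (p (\<chi> j. sin (\<delta> * x $ j))))"
  using assms
proof induction
  case (linear f)
  interpret bounded_linear f by fact
  have expand: "f y = (\<Sum>j\<in>UNIV. y $ j * f (axis j 1))" for y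
  proof -
    have "f y = f (\<Sum>j\<in>UNIV. y $ j *\<^sub>R axis j 1)"
      by (rule arg_cong[OF basis_expansion[of y, unfolded scalar_mult_eq_scaleR, symmetric]])
    then show ?thesis by (simp add: sum scaleR)
  qed
  have "(\<lambda>x :: real ^ 'd. complex_of_real (f (\<chi> j. sin (\<delta> * x $ j)))) =
    (\<lambda>x. \<Sum>j\<in>UNIV. complex_of_real (f (axis j 1)) * complex_of_real (sin ((\<delta> *\<^sub>R axis j 1) \<bullet> x)))"
    by (subst expand) (simp add: inner_axis' mult.commute)
  moreover have "trig_poly \<dots>"
    by (intro trig_poly_sum trig_poly_mult trig_poly_const trig_poly_sin) auto
  ultimately show ?case by (simp only:)
next
  case (const c)
  show ?case by (rule trig_poly_const)
next
  case (add p q)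
  show ?case unfolding of_real_add by (rule trig_poly.add[OF add.IH])
next
  case (mult p q)
  show ?case unfolding of_real_mult by (rule trig_poly_mult[OF mult.IH])
qed

lemma trig_poly_measurable: "trig_poly f \<Longrightarrow> f \<in> borel_measurable borel"
  by (induction rule: trig_poly.induct) auto

lemma trig_poly_bounded: "trig_poly f \<Longrightarrow> \<exists>B. \<forall>x. norm (f x) \<le> B"
proof (induction rule: trig_poly.induct)
  case (wave c t)
  then show ?case by (auto intro!: exI[of _ "norm c"] simp: norm_mult)
next
  case (add f g)
  then obtain A B where "\<forall>x. norm (f x) \<le> A" "\<forall>x. norm (g x) \<le> B" by auto
  then show ?case by (intro exI[of _ "A + B"]) (meson add_mono norm_triangle_le)
qed

lemma trig_poly_integrable:
  assumes "trig_poly f" "borel_prob L"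
  shows "integrable L f"
proof -
  interpret prob_space L using assms by (simp add: borel_prob_def)
  have [measurable_cong]: "sets L = sets borel" using assms by (simp add: borel_prob_def)
  note [measurable] = trig_poly_measurable[OF assms(1)]
  obtain B where "\<And>x. norm (f x) \<le> B" using trig_poly_bounded[OF assms(1)] by blast
  then show ?thesis by (intro integrable_const_bound[where B=B]) auto
qed

lemma trig_poly_integral_tendsto:
  assumes "trig_poly f" and "\<And>n. borel_prob (\<mu> n)" "borel_prob \<nu>"
    and "\<And>t. (\<lambda>n. mchar (\<mu> n) t) \<longlonglongrightarrow> mchar \<nu> t"
  shows "(\<lambda>n. \<integral>x. f x \<partial>\<mu> n) \<longlonglongrightarrow> (\<integral>x. f x \<partial>\<nu>)"
  using assms(1)
proof induction
  case (wave c t)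
  show ?case using tendsto_mult[OF tendsto_const assms(4)] by (simp add: mchar_def)
next
  case (add f g)
  then show ?case
    using tendsto_add[OF add.IH] by (simp add: trig_poly_integrable assms)
qed

subsection \<open>The continuity theorem in several dimensions\<close>

text \<open>
  A continuous majorant of the indicator of \<open>\<bar>y\<bar> > k + 1\<close>, so that tightness follows from weak
  convergence of the coordinates.
\<close>

definition escape :: "real \<Rightarrow> real \<Rightarrow> real" where
  "escape k y = min 1 (max 0 (\<bar>y\<bar> - k))"

lemma escape_bounds: "0 \<le> escape k y" "escape k y \<le> 1"
  by (auto simp: escape_def)

lemma escape_eq_1: "\<bar>y\<bar> > k + 1 \<Longrightarrow> escape k y = 1"
  by (auto simp: escape_def)

lemma escape_measurable [measurable]: "escape k \<in> borel_measurable borel"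
  unfolding escape_def by measurable

lemma integrable_escape:
  assumes "borel_prob (L :: (real^'d) measure)"
  shows "integrable L (\<lambda>x. escape k (x $ j))"
proof -
  interpret prob_space L using assms by (simp add: borel_prob_def)
  have [measurable_cong]: "sets L = sets borel" using assms by (simp add: borel_prob_def)
  show ?thesis
    by (rule integrable_const_bound[where B=1]) (auto simp: escape_bounds)
qed

lemma escape_integral_small:
  assumes "borel_prob (L :: (real^'d) measure)" "\<eta> > 0"
  shows "\<exists>k::nat. (\<Sum>j\<in>UNIV. \<integral>x. escape (real k) (x $ j) \<partial>L) < \<eta>"
proof -
  interpret prob_space L using assms by (simp add: borel_prob_def)
  have [measurable_cong]: "sets L = sets borel" using assms by (simp add: borel_prob_def)
  have "(\<lambda>k::nat. \<integral>x. escape (real k) (x $ j) \<partial>L) \<longlonglongrightarrow> (\<integral>x. 0 \<partial>L)" for j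
  proof (rule integral_dominated_convergence[where w="\<lambda>_. 1"])
    show "AE x in L. (\<lambda>k. escape (real k) (x $ j)) \<longlonglongrightarrow> 0"
    proof (rule AE_I2)
      fix x
      show "(\<lambda>k. escape (real k) (x $ j)) \<longlonglongrightarrow> 0"
      proof (rule tendsto_eventually)
        obtain N :: nat where "\<bar>x $ j\<bar> \<le> real N" using real_arch_simple by blast
        then have "\<forall>k\<ge>N. escape (real k) (x $ j) = 0" by (auto simp: escape_def)
        then show "eventually (\<lambda>k. escape (real k) (x $ j) = 0) sequentially"
          by (auto simp: eventually_sequentially)
      qed
    qed
  qed (auto simp: escape_bounds)
  then have "(\<lambda>k::nat. \<Sum>j\<in>UNIV. \<integral>x. escape (real k) (x $ j) \<partial>L) \<longlonglongrightarrow> (\<Sum>j\<in>(UNIV::'d set). \<integral>x. 0 \<partial>L)"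
    by (intro tendsto_sum)
  then have "eventually (\<lambda>k::nat. (\<Sum>j\<in>UNIV. \<integral>x. escape (real k) (x $ j) \<partial>L) < \<eta>) sequentially"
    using assms(2) by (auto dest: order_tendstoD(2))
  then show ?thesis by (auto simp: eventually_sequentially)
qed

text \<open>The characteristic function of the \<open>j\<close>-th marginal is \<open>mchar\<close>
  along the \<open>j\<close>-th axis, so Levy's theorem on the line applies to the
  marginals.\<close>

lemma escape_integral_tendsto:
  fixes \<mu> :: "nat \<Rightarrow> (real^'d) measure"
  assumes \<mu>: "\<And>n. borel_prob (\<mu> n)" and \<nu>: "borel_prob \<nu>"
    and conv: "\<And>t. (\<lambda>n. mchar (\<mu> n) t) \<longlonglongrightarrow> mchar \<nu> t"
  shows "(\<lambda>n. \<integral>x. escape k (x $ j) \<partial>\<mu> n) \<longlonglongrightarrow> (\<integral>x. escape k (x $ j) \<partial>\<nu>)"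
proof -
  let ?p = "\<lambda>L :: (real^'d) measure. distr L borel (\<lambda>x. x $ j)"
  have [measurable_cong]: "sets (\<mu> n) = sets borel" for n using \<mu> by (simp add: borel_prob_def)
  have [measurable_cong]: "sets \<nu> = sets borel" using \<nu> by (simp add: borel_prob_def)
  have bp: "borel_prob (?p L)" if "borel_prob L" for L
    using that by (intro borel_prob_distr) (auto simp: borel_prob_def cong: measurable_cong_sets)
  have mc: "char (?p L) s = mchar L (s *\<^sub>R axis j 1)" if "borel_prob L" for L s
  proof -
    have [measurable_cong]: "sets L = sets borel" using that by (simp add: borel_prob_def)
    show ?thesis unfolding char_eq_mchar
      by (subst mchar_distr) (simp_all add: mchar_def inner_axis')
  qed
  have rd: "real_distribution (?p (\<mu> n))" "real_distribution (?p \<nu>)" for n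
    using \<mu> \<nu> by (auto intro: borel_prob_imp_real_distribution bp)
  have wc: "weak_conv_m (\<lambda>n. ?p (\<mu> n)) (?p \<nu>)"
    by (rule levy_continuity[OF rd]) (simp add: mc \<mu> \<nu> conv)
  have "isCont (escape k) y" for y
    unfolding escape_def by (intro continuous_intros)
  then have "(\<lambda>n. \<integral>y. escape k y \<partial>?p (\<mu> n)) \<longlonglongrightarrow> (\<integral>y. escape k y \<partial>?p \<nu>)"
    by (rule weak_conv_imp_integral_bdd_continuous_conv[OF rd wc, where B=1]) (auto simp: escape_bounds)
  then show ?thesis by (simp add: integral_distr)
qed

text \<open>
  Polynomials in \<open>sin (\<delta> * x $ j)\<close> are bounded on the whole space: approximating
  \<open>f (\<chi> j. arcsin (y $ j) / \<delta>)\<close> on the cube \<open>{-1..1}\<close> therefore controls the error outside a large cube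
  as well, without any truncation of \<open>f\<close>.
\<close>

lemma trig_approx:
  fixes f :: "real ^ 'd \<Rightarrow> real"
  assumes f: "continuous_on UNIV f" and B: "\<And>x. \<bar>f x\<bar> \<le> B" and \<epsilon>: "\<epsilon> > 0" and k: "k \<ge> 0"
  obtains h where "trig_poly (\<lambda>x. complex_of_real (h x))"
    and "\<And>x. \<bar>f x - h x\<bar> \<le> \<epsilon> + (2 * B + \<epsilon>) * (\<Sum>j\<in>UNIV. escape k (x $ j))"
proof -
  \<comment> \<open>This scale maps \<open>[-(k+1), k+1]\<close> onto \<open>[-pi/2, pi/2]\<close>,
    where \<open>arcsin\<close> inverts \<open>sin\<close>; outside that interval
    \<open>escape k\<close> equals 1.\<close>
  define \<delta> where "\<delta> = pi / (2 * (k + 1))"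
  have \<delta>: "\<delta> > 0" "\<delta> * (k + 1) = pi / 2" using k by (auto simp: \<delta>_def field_simps)
  define F where "F y = f (\<chi> j. arcsin (y $ j) / \<delta>)" for y :: "real^'d"
  let ?S = "{- 1..1} :: (real^'d) set"
  have "continuous_on ?S F"
    unfolding F_def using \<delta>(1)
    by (intro continuous_on_compose2[OF f] continuous_intros)
       (auto simp: less_eq_vec_def)
  moreover have "compact ?S" by simp
  ultimately obtain p where p: "real_polynomial_function p" "\<And>y. y \<in> ?S \<Longrightarrow> \<bar>F y - p y\<bar> < \<epsilon>"
    using Stone_Weierstrass_real_polynomial_function \<epsilon> by metis
  define s where "s x = (\<chi> j. sin (\<delta> * x $ j))" for x :: "real^'d"
  define h where "h x = p (s x)" for x
  have s: "s x \<in> ?S" for x by (auto simp: s_def less_eq_vec_def)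
  have "B \<ge> 0" using B[of 0] by linarith
  show ?thesis
  proof
    show "trig_poly (\<lambda>x. complex_of_real (h x))"
      unfolding h_def s_def by (rule trig_poly_polynomial_sin) fact
    fix x
    show "\<bar>f x - h x\<bar> \<le> \<epsilon> + (2 * B + \<epsilon>) * (\<Sum>j\<in>UNIV. escape k (x $ j))"
    proof (cases "\<exists>i. \<bar>x $ i\<bar> > k + 1")
      case True
      then obtain i where i: "escape k (x $ i) = 1" using escape_eq_1 by blast
      have "1 \<le> (\<Sum>j\<in>UNIV. escape k (x $ j))"
        using member_le_sum[of i UNIV "\<lambda>j. escape k (x $ j)"] i by (auto simp: escape_bounds)
      then have *: "(2 * B + \<epsilon>) * 1 \<le> (2 * B + \<epsilon>) * (\<Sum>j\<in>UNIV. escape k (x $ j))"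
        using \<open>B \<ge> 0\<close> \<epsilon> by (intro mult_left_mono) auto
      \<comment> \<open>Far out \<open>h\<close> is still within \<epsilon> of a value of
        \<open>f\<close>, though at another point, so \<open>f\<close> and \<open>h\<close> differ
        by at most \<open>2 * B + \<epsilon>\<close>. One escaping coordinate pays for this.\<close>
      have "\<bar>F (s x)\<bar> \<le> B" by (simp add: F_def B)
      then have "\<bar>f x - h x\<bar> \<le> \<epsilon> + (2 * B + \<epsilon>) * 1"
        using p(2)[OF s[of x]] B[of x] \<epsilon> unfolding h_def by simp
      also have "\<dots> \<le> \<epsilon> + (2 * B + \<epsilon>) * (\<Sum>j\<in>UNIV. escape k (x $ j))"
        using * by (rule add_left_mono)
      finally show ?thesis .
    next
      case False
      have angle: "\<bar>\<delta> * x $ j\<bar> \<le> pi / 2" for j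
      proof -
        have "\<delta> * \<bar>x $ j\<bar> \<le> \<delta> * (k + 1)" using False \<delta>(1) by (intro mult_left_mono) (auto simp: not_less)
        then show ?thesis using \<delta> by (simp add: abs_mult)
      qed
      have "arcsin (sin (\<delta> * x $ j)) = \<delta> * x $ j" for j
        using angle[of j] by (intro arcsin_sin) linarith+
      then have "F (s x) = f x" using \<delta>(1) by (simp add: F_def s_def)
      then have "\<bar>f x - h x\<bar> \<le> \<epsilon>" using p(2)[OF s[of x]] by (simp add: h_def)
      moreover have "0 \<le> (2 * B + \<epsilon>) * (\<Sum>j\<in>UNIV. escape k (x $ j))"
        using \<open>B \<ge> 0\<close> \<epsilon> by (intro mult_nonneg_nonneg sum_nonneg) (auto simp: escape_bounds)
      ultimately show ?thesis by linarith
    qed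
  qed
qed

lemma levy_continuity_vec:
  fixes \<mu> :: "nat \<Rightarrow> (real^'d) measure"
  assumes \<mu>: "\<And>n. borel_prob (\<mu> n)" and \<nu>: "borel_prob \<nu>"
    and conv: "\<And>t. (\<lambda>n. mchar (\<mu> n) t) \<longlonglongrightarrow> mchar \<nu> t"
  shows "weak_conv_vec \<mu> \<nu>"
  unfolding weak_conv_vec_def
proof (intro allI impI, elim conjE)
  fix f :: "real^'d \<Rightarrow> real"
  assume f: "continuous_on UNIV f" and "bounded (range f)"
  then obtain B where B: "\<And>x. \<bar>f x\<bar> \<le> B" by (auto simp: bounded_iff)
  have "B \<ge> 0" using B[of 0] by linarith
  have f_meas: "f \<in> borel_measurable borel" using f by (rule borel_measurable_continuous_onI)
  show "(\<lambda>n. \<integral>x. f x \<partial>\<mu> n) \<longlonglongrightarrow> (\<integral>x. f x \<partial>\<nu>)"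
  proof (rule LIMSEQ_I)
    fix e :: real assume "e > 0"
    \<comment> \<open>The error budget: approximation and escape cost at most 2\<epsilon> for
      \<open>\<mu> n\<close> and 2\<epsilon> for \<nu>, and the convergence of the integrals of
      \<open>h\<close> costs one more \<epsilon>.\<close>
    define \<epsilon> where "\<epsilon> = e / 5"
    define C where "C = 2 * B + \<epsilon>"
    have \<epsilon>: "\<epsilon> > 0" and C: "C > 0" using \<open>e > 0\<close> \<open>B \<ge> 0\<close> by (auto simp: \<epsilon>_def C_def add_nonneg_pos)
    obtain k :: nat where k: "(\<Sum>j\<in>UNIV. \<integral>x. escape (real k) (x $ j) \<partial>\<nu>) < \<epsilon> / C"
      using escape_integral_small[OF \<nu>, of "\<epsilon> / C"] \<epsilon> C by auto
    obtain h where h: "trig_poly (\<lambda>x. complex_of_real (h x))"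
      and fh: "\<And>x. \<bar>f x - h x\<bar> \<le> \<epsilon> + C * (\<Sum>j\<in>UNIV. escape k (x $ j))"
      using trig_approx[OF f B \<epsilon>, of "real k"] unfolding C_def by auto
    have diff: "\<bar>(\<integral>x. f x \<partial>L) - (\<integral>x. h x \<partial>L)\<bar> \<le> \<epsilon> + C * (\<Sum>j\<in>UNIV. \<integral>x. escape k (x $ j) \<partial>L)"
      if L: "borel_prob L" for L
    proof -
      interpret prob_space L using L by (simp add: borel_prob_def)
      have sL: "sets L = sets borel" using L by (simp add: borel_prob_def)
      have f_int: "integrable L f"
        by (rule integrable_const_bound[where B=B]) (use f_meas sL B in \<open>auto cong: measurable_cong_sets\<close>)
      have h_int: "integrable L h"
        using integrable_Re[OF trig_poly_integrable[OF h L]] by simp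
      have e_int: "integrable L (\<lambda>x. \<epsilon> + C * (\<Sum>j\<in>UNIV. escape k (x $ j)))"
        using integrable_escape[OF L] by (intro Bochner_Integration.integrable_add integrable_mult_right Bochner_Integration.integrable_sum) auto
      have "\<bar>(\<integral>x. f x \<partial>L) - (\<integral>x. h x \<partial>L)\<bar> = \<bar>\<integral>x. f x - h x \<partial>L\<bar>"
        using f_int h_int by simp
      also have "\<dots> \<le> (\<integral>x. \<bar>f x - h x\<bar> \<partial>L)" by (rule integral_abs_bound)
      also have "\<dots> \<le> (\<integral>x. \<epsilon> + C * (\<Sum>j\<in>UNIV. escape k (x $ j)) \<partial>L)"
        using f_int h_int e_int fh by (intro integral_mono) auto
      also have "\<dots> = \<epsilon> + C * (\<Sum>j\<in>UNIV. \<integral>x. escape k (x $ j) \<partial>L)"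
        using integrable_escape[OF L] by (simp add: prob_space)
      finally show ?thesis .
    qed
    have "(\<lambda>n. complex_of_real (\<integral>x. h x \<partial>\<mu> n)) \<longlonglongrightarrow> complex_of_real (\<integral>x. h x \<partial>\<nu>)"
      using trig_poly_integral_tendsto[OF h \<mu> \<nu> conv] by simp
    then have "(\<lambda>n. \<integral>x. h x \<partial>\<mu> n) \<longlonglongrightarrow> (\<integral>x. h x \<partial>\<nu>)" by (simp only: tendsto_of_real_iff)
    from tendstoD[OF this \<epsilon>]
    have "eventually (\<lambda>n. \<bar>(\<integral>x. h x \<partial>\<mu> n) - (\<integral>x. h x \<partial>\<nu>)\<bar> < \<epsilon>) sequentially"
      by (simp add: dist_real_def)
    moreover have "eventually (\<lambda>n. (\<Sum>j\<in>UNIV. \<integral>x. escape k (x $ j) \<partial>\<mu> n) < \<epsilon> / C) sequentially"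
      by (rule order_tendstoD(2)[OF _ k]) (intro tendsto_sum escape_integral_tendsto \<mu> \<nu> conv)
    ultimately have "eventually (\<lambda>n. norm ((\<integral>x. f x \<partial>\<mu> n) - (\<integral>x. f x \<partial>\<nu>)) < e) sequentially"
    proof eventually_elim
      case (elim n)
      have small: "C * s < \<epsilon>" if "s < \<epsilon> / C" for s
        using that C by (simp add: field_simps)
      show ?case
        using diff[OF \<mu>[of n]] diff[OF \<nu>] elim(1) small[OF elim(2)] small[OF k]
        unfolding \<epsilon>_def real_norm_def by linarith
    qed
    then show "\<exists>no. \<forall>n\<ge>no. norm ((\<integral>x. f x \<partial>\<mu> n) - (\<integral>x. f x \<partial>\<nu>)) < e"
      by (simp add: eventually_sequentially)
  qed
qed

subsection \<open>Domains of attraction and characteristic functions\<close>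

lemma tendsto_subseqI:
  fixes f :: "nat \<Rightarrow> 'a::metric_space"
  assumes "\<And>r :: nat \<Rightarrow> nat. strict_mono r \<Longrightarrow> \<exists>r' :: nat \<Rightarrow> nat. strict_mono r' \<and> (f \<circ> r \<circ> r') \<longlonglongrightarrow> l"
  shows "f \<longlonglongrightarrow> l"
proof (rule ccontr)
  assume "\<not> f \<longlonglongrightarrow> l"
  then obtain e where e: "e > 0" "\<And>N. \<exists>n\<ge>N. \<not> dist (f n) l < e"
    unfolding tendsto_iff eventually_sequentially by blast
  then have "infinite {n. \<not> dist (f n) l < e}"
    by (auto simp: infinite_nat_iff_unbounded_le)
  from infinite_enumerate[OF this] obtain r :: "nat \<Rightarrow> nat"
    where r: "strict_mono r" "\<And>n. \<not> dist (f (r n)) l < e" by auto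
  from assms[OF r(1)] obtain r' where "(f \<circ> r \<circ> r') \<longlonglongrightarrow> l" by blast
  from tendstoD[OF this e(1)] r(2) show False by (auto simp: eventually_sequentially)
qed

context
  fixes M :: "'a measure"
  assumes M: "prob_space M"
begin

lemma mchar_DAN_law:
  fixes X :: "'a \<Rightarrow> real"
  assumes X: "X \<in> borel_measurable M"
  shows "mchar (distr (iid_law M X) borel (\<lambda>\<omega>. ((\<Sum>i<n. \<omega> i) - a) * inverse b)) s =
    cis (- (s / b * a)) * mchar (distr M borel X) (s / b) ^ n"
  using mchar_iid_sum[OF M X, of "s / b" n a]
  by (subst mchar_distr) (auto simp: divide_inverse mult_ac)

lemma borel_prob_DAN_law:
  fixes X :: "'a \<Rightarrow> real"
  assumes "X \<in> borel_measurable M"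
  shows "borel_prob (distr (iid_law M X) borel (\<lambda>\<omega>. ((\<Sum>i<n. \<omega> i) - a) * inverse b))"
  by (intro borel_prob_distr prob_space_iid_law M assms) measurable

lemma borel_prob_std_normal: "borel_prob std_normal_distribution"
  by (simp add: borel_prob_def prob_space_normal_density)

lemma DANI:
  fixes X :: "'a \<Rightarrow> real"
  assumes X: "X \<in> borel_measurable M" and b: "\<And>n. b n > 0"
    and "\<And>s. (\<lambda>n. cis (- (s / b n * a n)) * mchar (distr M borel X) (s / b n) ^ n)
      \<longlonglongrightarrow> complex_of_real (exp (- s\<^sup>2 / 2))"
  shows "DAN M X"
  unfolding DAN_def
proof (intro exI conjI allI)
  show "weak_conv_m (\<lambda>n. distr (iid_law M X) borel (\<lambda>\<omega>. ((\<Sum>i<n. \<omega> i) - a n) * inverse (b n)))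
    std_normal_distribution"
    using assms
    by (intro levy_continuity borel_prob_imp_real_distribution borel_prob_DAN_law real_dist_normal_dist)
       (simp_all add: char_eq_mchar mchar_DAN_law char_std_normal_distribution[unfolded char_eq_mchar[abs_def] fun_eq_iff])
qed (rule b)

text \<open>
  The arguments \<open>s\<close> may vary along a subsequence \<open>q\<close>; this locally uniform form is what determines the
  growth of \<open>b\<close> below.
\<close>

lemma DAND:
  fixes X :: "'a \<Rightarrow> real"
  assumes X: "X \<in> borel_measurable M" and "DAN M X"
  obtains a b where "\<And>n. b n > 0"
    and "\<And>(s :: nat \<Rightarrow> real) s' q. s \<longlonglongrightarrow> s' \<Longrightarrow> strict_mono q \<Longrightarrow>
      (\<lambda>k. cis (- (s k / b (q k) * a (q k))) * mchar (distr M borel X) (s k / b (q k)) ^ q k)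
      \<longlonglongrightarrow> complex_of_real (exp (- s'\<^sup>2 / 2))"
proof -
  from assms obtain a b where b: "\<And>n. b n > 0"
    and wc: "weak_conv_m (\<lambda>n. distr (iid_law M X) borel (\<lambda>\<omega>. ((\<Sum>i<n. \<omega> i) - a n) * inverse (b n)))
      std_normal_distribution"
    unfolding DAN_def by blast
  define L where "L n = distr (iid_law M X) borel (\<lambda>\<omega>. ((\<Sum>i<n. \<omega> i) - a n) * inverse (b n))" for n
  have bpL: "borel_prob (L n)" for n unfolding L_def by (rule borel_prob_DAN_law[OF X])
  have wc: "weak_conv_m L std_normal_distribution" using wc by (simp add: L_def[abs_def])
  show thesis
  proof (rule that[OF b])
    fix s :: "nat \<Rightarrow> real" and s' :: real and q :: "nat \<Rightarrow> nat"
    assume s: "s \<longlonglongrightarrow> s'" and q: "strict_mono q"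
    have "(\<lambda>k. mchar (L (q k)) (s k)) \<longlonglongrightarrow> mchar std_normal_distribution s'"
    proof (rule mchar_uniform_tendsto[OF bpL borel_prob_std_normal _ s])
      fix f :: "real \<Rightarrow> real"
      assume f: "continuous_on UNIV f" "bounded (range f)"
      then obtain B where "\<And>x. norm (f x) \<le> B" by (auto simp: bounded_iff)
      with f(1) have "(\<lambda>n. \<integral>x. f x \<partial>L n) \<longlonglongrightarrow> (\<integral>x. f x \<partial>std_normal_distribution)"
        by (intro weak_conv_imp_integral_bdd_continuous_conv[OF _ _ wc] borel_prob_imp_real_distribution
            bpL borel_prob_std_normal)
           (auto simp: continuous_on_eq_continuous_at)
      from LIMSEQ_subseq_LIMSEQ[OF this q]
      show "(\<lambda>k. \<integral>x. f x \<partial>L (q k)) \<longlonglongrightarrow> (\<integral>x. f x \<partial>std_normal_distribution)"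
        by (simp add: o_def)
    qed
    then show "(\<lambda>k. cis (- (s k / b (q k) * a (q k))) * mchar (distr M borel X) (s k / b (q k)) ^ q k)
      \<longlonglongrightarrow> complex_of_real (exp (- s'\<^sup>2 / 2))"
      by (simp add: L_def mchar_DAN_law[OF X] char_std_normal_distribution[unfolded char_eq_mchar[abs_def] fun_eq_iff])
  qed
qed

section \<open>Normalised vector sums and their projections\<close>

context
  fixes Z :: "'a \<Rightarrow> real ^ 'd"
  assumes Z [measurable]: "Z \<in> borel_measurable M"
begin

lemma GDAN_law_measurable [measurable]:
  "(\<lambda>\<omega>. ((\<Sum>i<n. \<omega> i) - a) v* transpose B) \<in> borel_measurable (PiM UNIV (\<lambda>_. borel :: (real^'d) measure))"
proof -
  have [measurable]: "(\<lambda>x. x v* transpose B) \<in> borel_measurable (borel :: (real^'d) measure)"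
    unfolding vector_transpose_matrix
    by (intro borel_measurable_continuous_onI linear_continuous_on matrix_vector_mul_bounded_linear)
  show ?thesis by measurable
qed

lemma borel_prob_GDAN_law:
  "borel_prob (distr (iid_law M Z) borel (\<lambda>\<omega>. ((\<Sum>i<n. \<omega> i) - a) v* transpose B))"
  by (intro borel_prob_distr prob_space_iid_law M Z) measurable

lemma mchar_GDAN_law:
  "mchar (distr (iid_law M Z) borel (\<lambda>\<omega>. ((\<Sum>i<n. \<omega> i) - a) v* transpose B)) t =
    cis (- ((t v* B) \<bullet> a)) * mchar (distr M borel Z) (t v* B) ^ n"
proof -
  have "t \<bullet> (x v* transpose B) = (t v* B) \<bullet> x" for x
    by (simp add: dot_lmul_matrix)
  moreover have "(\<lambda>\<omega>. ((\<Sum>i<n. \<omega> i) - a) v* transpose B) \<in> borel_measurable (iid_law M Z)"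
    by measurable
  ultimately show ?thesis
    using mchar_iid_sum[OF M Z, of "t v* B" n a]
    by (subst mchar_distr) auto
qed

lemma GDANI:
  fixes B :: "nat \<Rightarrow> real ^ 'd ^ 'd"
  assumes "\<And>t. (\<lambda>n. cis (- ((t v* B n) \<bullet> a n)) * mchar (distr M borel Z) (t v* B n) ^ n)
      \<longlonglongrightarrow> complex_of_real (exp (- (norm t)\<^sup>2 / 2))"
  shows "GDAN M Z"
  unfolding GDAN_def
proof (intro exI)
  show "weak_conv_vec (\<lambda>n. distr (iid_law M Z) borel (\<lambda>\<omega>. ((\<Sum>i<n. \<omega> i) - a n) v* transpose (B n)))
    std_normal_vec"
    using assms
    by (intro levy_continuity_vec borel_prob_GDAN_law borel_prob_std_normal_vec)
       (simp add: mchar_GDAN_law mchar_std_normal_vec del: vector_transpose_matrix)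
qed

text \<open>For invertible \<open>B\<close> the vector is the normalised solution of
  \<open>w v* B = axis j 1\<close>. For singular \<open>B\<close> that equation may have no
  solution, and a unit vector of the left kernel is taken instead; this second alternative is ruled
  out for large \<open>n\<close> by its probabilistic meaning.\<close>

lemma unit_vector_matrix_direction:
  fixes B :: "real ^ 'n ^ 'n"
  shows "\<exists>u c. norm u = 1 \<and> (c > 0 \<and> u v* B = (1 / c) *\<^sub>R axis j 1 \<or> u v* B = 0)"
proof (cases "invertible B")
  case True
  then obtain A where A: "A ** B = mat 1" by (auto simp: invertible_def)
  define w where "w = axis j 1 v* A"
  have w: "w v* B = axis j 1" by (simp add: w_def vector_matrix_mul_assoc A)
  then have "w \<noteq> 0" by (auto simp: axis_eq_0_iff)
  have "(w /\<^sub>R norm w) v* B = (1 / norm w) *\<^sub>R axis j 1"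
    by (simp add: scaleR_vector_matrix_assoc w inverse_eq_divide)
  moreover have "norm (w /\<^sub>R norm w) = 1" "norm w > 0" using \<open>w \<noteq> 0\<close> by auto
  ultimately show ?thesis by blast
next
  case False
  then have "\<not> invertible (transpose B)" by (simp add: invertible_det_nz)
  then have "\<not> (\<exists>A. A ** transpose B = mat 1)" by (simp add: invertible_left_inverse)
  then obtain w where w: "w \<noteq> 0" "transpose B *v w = 0"
    by (auto simp: matrix_left_invertible_ker)
  then have "(w /\<^sub>R norm w) v* B = 0" "norm (w /\<^sub>R norm w) = 1"
    by (simp_all add: scaleR_vector_matrix_assoc)
  then show ?thesis by blast
qed

lemma GDAN_imp_DAN:
  assumes "GDAN M Z"
  shows "DAN M (\<lambda>\<omega>. Z \<omega> $ j)"
proof -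
  from assms obtain a :: "nat \<Rightarrow> real ^ 'd" and B :: "nat \<Rightarrow> real ^ 'd ^ 'd" where
    "weak_conv_vec (\<lambda>n. distr (iid_law M Z) borel (\<lambda>\<omega>. ((\<Sum>i<n. \<omega> i) - a n) v* transpose (B n)))
      std_normal_vec" unfolding GDAN_def by (elim exE)
  moreover define G where "G n = distr (iid_law M Z) borel (\<lambda>\<omega>. ((\<Sum>i<n. \<omega> i) - a n) v* transpose (B n))" for n
  ultimately have wc: "weak_conv_vec G std_normal_vec" by (simp only: G_def[abs_def])
  have bpG: "borel_prob (G n)" for n unfolding G_def by (rule borel_prob_GDAN_law)
  obtain u c where u: "\<And>n. norm (u n) = 1"
    and uc: "\<And>n. c n > 0 \<and> u n v* B n = (1 / c n) *\<^sub>R axis j 1 \<or> u n v* B n = 0"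
  proof -
    have "\<forall>n. \<exists>u c. norm u = 1 \<and> (c > 0 \<and> u v* B n = (1 / c) *\<^sub>R axis j 1 \<or> u v* B n = 0)"
      by (intro allI unit_vector_matrix_direction)
    from choice[OF this] obtain u where
      "\<forall>n. \<exists>c. norm (u n) = 1 \<and> (c > 0 \<and> u n v* B n = (1 / c) *\<^sub>R axis j 1 \<or> u n v* B n = 0)" ..
    from choice[OF this] that show thesis by blast
  qed
  have lim: "(\<lambda>n. mchar (G n) (s *\<^sub>R u n)) \<longlonglongrightarrow> complex_of_real (exp (- s\<^sup>2 / 2))" for s
  \<comment> \<open>The directions \<open>u n\<close> need not converge. Along any convergent
    subsequence, however, the limit depends only on the norm of the limiting direction, which is 1,
    so all subsequential limits agree.\<close>
  proof (rule tendsto_subseqI)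
    fix r :: "nat \<Rightarrow> nat" assume r: "strict_mono r"
    have "compact (sphere 0 1 :: (real^'d) set)" by simp
    moreover have "\<forall>n. (u \<circ> r) n \<in> sphere 0 1" by (simp add: u)
    ultimately obtain l and r' :: "nat \<Rightarrow> nat" where l: "l \<in> sphere 0 1" "strict_mono r'" "(u \<circ> r \<circ> r') \<longlonglongrightarrow> l"
      unfolding compact_def by metis
    have "(\<lambda>n. mchar (G (r (r' n))) (s *\<^sub>R u (r (r' n)))) \<longlonglongrightarrow> mchar std_normal_vec (s *\<^sub>R l)"
    proof (rule mchar_uniform_tendsto[OF bpG borel_prob_std_normal_vec])
      show "(\<lambda>n. s *\<^sub>R u (r (r' n))) \<longlonglongrightarrow> s *\<^sub>R l"
        using l(3) by (intro tendsto_intros) (simp add: o_def)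
      fix f :: "real^'d \<Rightarrow> real" assume "continuous_on UNIV f" "bounded (range f)"
      with wc have "(\<lambda>n. \<integral>x. f x \<partial>G n) \<longlonglongrightarrow> (\<integral>x. f x \<partial>std_normal_vec)"
        by (auto simp: weak_conv_vec_def)
      from LIMSEQ_subseq_LIMSEQ[OF this strict_mono_o[OF r l(2)]]
      show "(\<lambda>n. \<integral>x. f x \<partial>G (r (r' n))) \<longlonglongrightarrow> (\<integral>x. f x \<partial>std_normal_vec)"
        by (simp add: o_def)
    qed
    then show "\<exists>r'. strict_mono r' \<and> ((\<lambda>n. mchar (G n) (s *\<^sub>R u n)) \<circ> r \<circ> r') \<longlonglongrightarrow> complex_of_real (exp (- s\<^sup>2 / 2))"
      using l(1,2) by (intro exI[of _ r']) (simp add: o_def mchar_std_normal_vec power_mult_distrib)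
  qed
  define P where "P n \<longleftrightarrow> c n > 0 \<and> u n v* B n = (1 / c n) *\<^sub>R axis j 1" for n
  \<comment> \<open>If \<open>u n\<close> is in the left kernel of \<open>B n\<close>, the
    projection on \<open>u n\<close> is constantly 0 and its characteristic function is 1. The limit
    at argument 1 is \<open>exp (-1/2)\<close>, so this happens for finitely many \<open>n\<close>
    only.\<close>
  have G1: "mchar (G n) (1 *\<^sub>R u n) = 1" if "\<not> P n" for n
    using that uc[of n] mchar_zero[OF borel_prob_distr[OF M Z]]
    unfolding G_def mchar_GDAN_law by (auto simp: P_def)
  have "complex_of_real (exp (- 1\<^sup>2 / 2)) \<noteq> 1" by (simp del: of_real_exp)
  from tendsto_imp_eventually_ne[OF lim this]
  have ev: "eventually P sequentially"
    by (rule eventually_mono) (use G1 in auto)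
  \<comment> \<open>The value 1 is a filler for the finitely many exceptional \<open>n\<close>,
    since \<open>DAN\<close> asks for positive norming constants at every \<open>n\<close>.\<close>
  define b where "b n = (if P n then c n else 1)" for n
  show ?thesis
  proof (rule DANI)
    show "(\<lambda>\<omega>. Z \<omega> $ j) \<in> borel_measurable M" by measurable
    show "b n > 0" for n by (simp add: b_def P_def)
    fix s
    have "eventually (\<lambda>n. mchar (G n) (s *\<^sub>R u n) =
      cis (- (s / b n * a n $ j)) * mchar (distr M borel (\<lambda>\<omega>. Z \<omega> $ j)) (s / b n) ^ n) sequentially"
      using ev
    proof eventually_elim
      case (elim n)
      have "(s *\<^sub>R u n) v* B n = (s / b n) *\<^sub>R axis j 1"
        using elim by (simp add: scaleR_vector_matrix_assoc P_def b_def)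
      then show ?case
        unfolding G_def mchar_GDAN_law
        by (simp add: inner_axis' mchar_distr)
    qed
    from Lim_transform_eventually[OF lim this]
    show "(\<lambda>n. cis (- (s / b n * a n $ j)) * mchar (distr M borel (\<lambda>\<omega>. Z \<omega> $ j)) (s / b n) ^ n)
      \<longlonglongrightarrow> complex_of_real (exp (- s\<^sup>2 / 2))" .
  qed
qed

end

end

subsection \<open>Coordinates with infinite variance\<close>

lemma quadratic_nonneg_imp_discriminant:
  fixes m p c :: real
  assumes "\<And>l. 0 \<le> c - 2 * l * m + l\<^sup>2 * p" "p \<ge> 0"
  shows "m\<^sup>2 \<le> p * c"
proof (cases "p = 0")
  case True
  have "m = 0"
  proof (rule ccontr)
    assume "m \<noteq> 0"
    \<comment> \<open>At this value of \<open>l\<close> the expression, linear in \<open>l\<close>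
      when \<open>p = 0\<close>, equals -1.\<close>
    then show False using assms(1)[of "(c + 1) / (2 * m)"] True by simp
  qed
  then show ?thesis using True by simp
next
  case False
  then have "p > 0" using assms(2) by simp
  then show ?thesis using assms(1)[of "m / p"] by (simp add: power2_eq_square field_simps)
qed

lemma (in prob_space) expectation_Cauchy_Schwarz:
  fixes f g :: "'a \<Rightarrow> real"
  assumes fg: "integrable M (\<lambda>x. f x * g x)" and f2: "integrable M (\<lambda>x. (f x)\<^sup>2)" and g2: "integrable M (\<lambda>x. (g x)\<^sup>2)"
  shows "(expectation (\<lambda>x. f x * g x))\<^sup>2 \<le> expectation (\<lambda>x. (f x)\<^sup>2) * expectation (\<lambda>x. (g x)\<^sup>2)"
proof (rule quadratic_nonneg_imp_discriminant)
  fix l :: real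
  have "0 \<le> expectation (\<lambda>x. (g x - l * f x)\<^sup>2)"
    by (rule Bochner_Integration.integral_nonneg) simp
  also have "(\<lambda>x. (g x - l * f x)\<^sup>2) = (\<lambda>x. (g x)\<^sup>2 - 2 * l * (f x * g x) + l\<^sup>2 * (f x)\<^sup>2)"
    by (auto simp: power2_eq_square algebra_simps)
  also have "expectation \<dots> = expectation (\<lambda>x. (g x)\<^sup>2) - 2 * l * expectation (\<lambda>x. f x * g x) + l\<^sup>2 * expectation (\<lambda>x. (f x)\<^sup>2)"
    using assms by simp
  finally show "0 \<le> expectation (\<lambda>x. (g x)\<^sup>2) - 2 * l * expectation (\<lambda>x. f x * g x) + l\<^sup>2 * expectation (\<lambda>x. (f x)\<^sup>2)" .
qed simp

text \<open>The constant is \<open>1/2 - 1/6\<close>: the Taylor remainder \<open>|y|^3 / 6\<close>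
  is at most \<open>y^2 / 6\<close> on this range.\<close>

lemma one_minus_cos_ge:
  fixes y :: real
  assumes "\<bar>y\<bar> \<le> 1"
  shows "y\<^sup>2 / 3 \<le> 1 - cos y"
proof -
  have "\<bar>Re (iexp y - (\<Sum>k\<le>2. (\<i> * y) ^ k / fact k))\<bar> \<le> \<bar>y\<bar> ^ 3 / 6"
    using order_trans[OF abs_Re_le_cmod iexp_approx1[of y 2]] by (simp add: fact_numeral numeral_3_eq_3)
  moreover have "Re (iexp y - (\<Sum>k\<le>2. (\<i> * y) ^ k / fact k)) = cos y - 1 + y\<^sup>2 / 2"
    by (simp add: numeral_2_eq_2 cis_conv_exp[symmetric] power2_eq_square)
  moreover have "\<bar>y\<bar> ^ 3 \<le> y\<^sup>2"
    using power_decreasing[of 2 3 "\<bar>y\<bar>"] assms by simp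
  ultimately show ?thesis by linarith
qed

text \<open>From \<open>x \<le> exp (x - 1)\<close> with \<open>x = |z|^2\<close> one gets
  \<open>|z|^(2m) \<le> exp (- m (1 - |z|^2))\<close>. The left side stays away from 0, so the
  exponent is bounded. The square is used because \<open>|z|^2\<close> splits into real and
  imaginary parts.\<close>

lemma power_limit_imp_bound:
  fixes z :: "nat \<Rightarrow> complex" and m :: "nat \<Rightarrow> nat"
  assumes lim: "(\<lambda>k. norm (z k) ^ m k) \<longlonglongrightarrow> L" and L: "L > 0"
  shows "\<exists>C. eventually (\<lambda>k. real (m k) * (1 - (norm (z k))\<^sup>2) \<le> C) sequentially"
proof (intro exI)
  have "eventually (\<lambda>k. norm (z k) ^ m k > L / 2) sequentially"
    using L by (intro order_tendstoD(1)[OF lim]) simp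
  then show "eventually (\<lambda>k. real (m k) * (1 - (norm (z k))\<^sup>2) \<le> - ln ((L / 2)\<^sup>2)) sequentially"
  proof eventually_elim
    case (elim k)
    have "(L / 2)\<^sup>2 \<le> (norm (z k) ^ m k)\<^sup>2" using elim L by (intro power_mono) auto
    also have "\<dots> = ((norm (z k))\<^sup>2) ^ m k" by (simp add: power_mult[symmetric] mult.commute)
    also have "\<dots> \<le> exp ((norm (z k))\<^sup>2 - 1) ^ m k"
      using exp_ge_add_one_self[of "(norm (z k))\<^sup>2 - 1"] by (intro power_mono) auto
    also have "\<dots> = exp (real (m k) * ((norm (z k))\<^sup>2 - 1))"
      by (simp add: exp_of_nat_mult)
    finally have "ln ((L / 2)\<^sup>2) \<le> ln (exp (real (m k) * ((norm (z k))\<^sup>2 - 1)))"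
      using L by (subst ln_le_cancel_iff) auto
    then show ?case by (simp add: algebra_simps)
  qed
qed

section \<open>Modulus, real part and second moment\<close>

context prob_space
begin

context
  fixes X :: "'a \<Rightarrow> real"
  assumes X [measurable]: "X \<in> borel_measurable M"
begin

abbreviation "chf \<tau> \<equiv> mchar (distr M borel X) \<tau>"
text \<open>The probability of \<open>|X| > K\<close>, written as the mean of an indicator so that
  it can appear directly as a factor in the Cauchy-Schwarz inequality.\<close>

abbreviation "tail K \<equiv> expectation (\<lambda>\<omega>. of_bool (\<bar>X \<omega>\<bar> > K) :: real)"

lemma integrable_bounded_trig:
  "integrable M (\<lambda>\<omega>. cos (\<tau> * X \<omega>))" "integrable M (\<lambda>\<omega>. sin (\<tau> * X \<omega>))"
  "integrable M (\<lambda>\<omega>. (sin (\<tau> * X \<omega>))\<^sup>2)" "integrable M (\<lambda>\<omega>. \<bar>sin (\<tau> * X \<omega>)\<bar>)"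
  "integrable M (\<lambda>\<omega>. of_bool (\<bar>X \<omega>\<bar> > K) :: real)"
  "integrable M (\<lambda>\<omega>. of_bool (\<bar>X \<omega>\<bar> > K) * \<bar>sin (\<tau> * X \<omega>)\<bar>)"
  by (rule integrable_const_bound[where B=1]; simp add: abs_mult abs_square_le_1 mult_le_one)+

lemma Re_chf: "Re (chf \<tau>) = expectation (\<lambda>\<omega>. cos (\<tau> * X \<omega>))"
  and Im_chf: "Im (chf \<tau>) = expectation (\<lambda>\<omega>. sin (\<tau> * X \<omega>))"
proof -
  have int: "integrable M (\<lambda>\<omega>. cis (\<tau> \<bullet> X \<omega>))" by (rule integrable_cis) measurable
  show "Re (chf \<tau>) = expectation (\<lambda>\<omega>. cos (\<tau> * X \<omega>))"
    unfolding mchar_distr[OF X] integral_Re[OF int, symmetric] by simp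
  show "Im (chf \<tau>) = expectation (\<lambda>\<omega>. sin (\<tau> * X \<omega>))"
    unfolding mchar_distr[OF X] integral_Im[OF int, symmetric] by simp
qed

lemma tail_tendsto_0: "(\<lambda>k::nat. tail (real k)) \<longlonglongrightarrow> 0"
proof -
  have "(\<lambda>k::nat. tail (real k)) \<longlonglongrightarrow> expectation (\<lambda>\<omega>. 0 :: real)"
  proof (rule integral_dominated_convergence[where w="\<lambda>_. 1"])
    show "AE \<omega> in M. (\<lambda>k. of_bool (\<bar>X \<omega>\<bar> > real k) :: real) \<longlonglongrightarrow> 0"
    proof (rule AE_I2)
      fix \<omega>
      obtain N :: nat where "\<bar>X \<omega>\<bar> \<le> real N" using real_arch_simple by blast
      then have "eventually (\<lambda>k. (of_bool (\<bar>X \<omega>\<bar> > real k) :: real) = 0) sequentially"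
        by (auto simp: eventually_sequentially intro!: exI[of _ N])
      then show "(\<lambda>k. of_bool (\<bar>X \<omega>\<bar> > real k) :: real) \<longlonglongrightarrow> 0"
        by (rule tendsto_eventually)
    qed
  qed auto
  then show ?thesis by simp
qed

text \<open>Where \<open>|X| \<le> K\<close> the sine is at most \<open>K * |\<tau>|\<close>; on the
  rest Cauchy-Schwarz and \<open>sin^2 \<le> 2 (1 - cos)\<close> apply. The point is the factor
  \<open>tail K\<close>: a fixed small value allows absorption in the next lemma, and an arbitrarily
  small one later gives the \<open>o(1 / sqrt n)\<close>.\<close>

lemma expectation_abs_sin_le:
  assumes "K \<ge> 0"
  shows "(expectation (\<lambda>\<omega>. \<bar>sin (\<tau> * X \<omega>)\<bar>))\<^sup>2 \<le> 2 * K\<^sup>2 * \<tau>\<^sup>2 + 4 * tail K * (1 - Re (chf \<tau>))"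
proof -
  let ?E = "expectation (\<lambda>\<omega>. of_bool (\<bar>X \<omega>\<bar> > K) * \<bar>sin (\<tau> * X \<omega>)\<bar>)"
  let ?S = "expectation (\<lambda>\<omega>. \<bar>sin (\<tau> * X \<omega>)\<bar>)"
  have E0: "?E \<ge> 0" by (rule Bochner_Integration.integral_nonneg) simp
  have S0: "?S \<ge> 0" by (rule Bochner_Integration.integral_nonneg) simp
  have tail0: "tail K \<ge> 0" by (rule Bochner_Integration.integral_nonneg) simp
  have "?S \<le> expectation (\<lambda>\<omega>. K * \<bar>\<tau>\<bar> + of_bool (\<bar>X \<omega>\<bar> > K) * \<bar>sin (\<tau> * X \<omega>)\<bar>)"
  proof (rule integral_mono)
    fix \<omega>
    have "\<bar>sin (\<tau> * X \<omega>)\<bar> \<le> \<bar>\<tau>\<bar> * \<bar>X \<omega>\<bar>" using abs_sin_x_le_abs_x[of "\<tau> * X \<omega>"] by (simp add: abs_mult)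
    moreover have "\<bar>\<tau>\<bar> * \<bar>X \<omega>\<bar> \<le> K * \<bar>\<tau>\<bar>" if "\<bar>X \<omega>\<bar> \<le> K"
      using mult_left_mono[OF that, of "\<bar>\<tau>\<bar>"] by (simp add: mult.commute)
    moreover have "K * \<bar>\<tau>\<bar> \<ge> 0" using assms by simp
    ultimately show "\<bar>sin (\<tau> * X \<omega>)\<bar> \<le> K * \<bar>\<tau>\<bar> + of_bool (\<bar>X \<omega>\<bar> > K) * \<bar>sin (\<tau> * X \<omega>)\<bar>"
      by (cases "\<bar>X \<omega>\<bar> > K") auto
  qed (auto intro!: integrable_bounded_trig Bochner_Integration.integrable_add)
  also have "\<dots> = K * \<bar>\<tau>\<bar> + ?E"
    by (subst Bochner_Integration.integral_add) (auto intro!: integrable_bounded_trig simp: prob_space)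
  finally have "?S\<^sup>2 \<le> (K * \<bar>\<tau>\<bar> + ?E)\<^sup>2" using S0 by (intro power_mono) auto
  also have "\<dots> \<le> 2 * (K * \<bar>\<tau>\<bar>)\<^sup>2 + 2 * ?E\<^sup>2"
    using sum_squares_bound[of "K * \<bar>\<tau>\<bar>" ?E] by (simp add: power2_sum)
  also have "?E\<^sup>2 \<le> expectation (\<lambda>\<omega>. (of_bool (\<bar>X \<omega>\<bar> > K))\<^sup>2) * expectation (\<lambda>\<omega>. \<bar>sin (\<tau> * X \<omega>)\<bar>\<^sup>2)"
    by (rule expectation_Cauchy_Schwarz; rule integrable_const_bound[where B=1];
        simp add: abs_mult abs_square_le_1 mult_le_one)
  also have "\<dots> \<le> tail K * (2 * (1 - Re (chf \<tau>)))"
  proof (rule mult_mono)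
    have "expectation (\<lambda>\<omega>. \<bar>sin (\<tau> * X \<omega>)\<bar>\<^sup>2) \<le> expectation (\<lambda>\<omega>. 2 * (1 - cos (\<tau> * X \<omega>)))"
    proof (rule integral_mono)
      fix \<omega>
      let ?c = "cos (\<tau> * X \<omega>)"
      have "(1 - ?c) * (1 + ?c) \<le> (1 - ?c) * 2"
        by (intro mult_left_mono) (auto simp: add.commute)
      moreover have "\<bar>sin (\<tau> * X \<omega>)\<bar>\<^sup>2 = (1 - ?c) * (1 + ?c)"
        by (simp add: sin_squared_eq power2_eq_square algebra_simps)
      ultimately show "\<bar>sin (\<tau> * X \<omega>)\<bar>\<^sup>2 \<le> 2 * (1 - ?c)" by simp
    qed (auto intro!: integrable_bounded_trig)
    then show "expectation (\<lambda>\<omega>. \<bar>sin (\<tau> * X \<omega>)\<bar>\<^sup>2) \<le> 2 * (1 - Re (chf \<tau>))"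
      by (simp add: Re_chf integrable_bounded_trig prob_space)
  qed (auto simp: power2_eq_square tail0 simp flip: of_bool_conj intro!: Bochner_Integration.integral_nonneg)
  finally show ?thesis by (simp add: power_mult_distrib algebra_simps)
qed

text \<open>
  Since centring constants are unknown, convergence only controls the modulus of the characteristic
  function; this replaces symmetrisation in passing from the modulus to the real part.
\<close>

lemma one_minus_Re_chf_le:
  assumes "K \<ge> 0" "tail K \<le> 1 / 8" "Re (chf \<tau>) \<ge> 0"
  shows "1 - Re (chf \<tau>) \<le> 2 * (1 - (norm (chf \<tau>))\<^sup>2) + 4 * K\<^sup>2 * \<tau>\<^sup>2"
proof -
  let ?c = "Re (chf \<tau>)"
  have c1: "?c \<le> 1"
    using norm_mchar_le_1[of "distr M borel X" \<tau>] complex_Re_le_cmod[of "chf \<tau>"]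
    by (simp add: borel_prob_distr prob_space_axioms)
  have "\<bar>Im (chf \<tau>)\<bar> \<le> expectation (\<lambda>\<omega>. \<bar>sin (\<tau> * X \<omega>)\<bar>)"
    unfolding Im_chf by (rule integral_abs_bound)
  then have "(Im (chf \<tau>))\<^sup>2 \<le> (expectation (\<lambda>\<omega>. \<bar>sin (\<tau> * X \<omega>)\<bar>))\<^sup>2"
    using power_mono[of "\<bar>Im (chf \<tau>)\<bar>" _ 2] by simp
  also have "\<dots> \<le> 2 * K\<^sup>2 * \<tau>\<^sup>2 + 4 * tail K * (1 - ?c)"
    by (rule expectation_abs_sin_le) fact
  \<comment> \<open>The threshold \<open>1 / 8\<close> makes the coefficient \<open>1 / 2\<close>,
    so half of \<open>1 - Re (chf \<tau>)\<close> is left over after the imaginary part has been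
    absorbed.\<close>
  also have "4 * tail K * (1 - ?c) \<le> 4 * (1 / 8) * (1 - ?c)"
    using assms c1 by (intro mult_right_mono) auto
  finally have "(Im (chf \<tau>))\<^sup>2 \<le> 2 * K\<^sup>2 * \<tau>\<^sup>2 + (1 - ?c) / 2" by simp
  moreover have "?c\<^sup>2 \<le> ?c" using assms c1 by (simp add: power2_eq_square mult_left_le)
  moreover have "1 - c \<le> 2 * (1 - (c2 + i2)) + 4 * A * B"
    if "i2 \<le> 2 * A * B + (1 - c) / 2" "c2 \<le> c" for c c2 i2 A B :: real
    using that by (simp add: field_simps)
  ultimately show ?thesis unfolding cmod_power2 by blast
qed

lemma chf_tendsto_1: "\<tau> \<longlonglongrightarrow> 0 \<Longrightarrow> (\<lambda>k. chf (\<tau> k)) \<longlonglongrightarrow> 1"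
proof -
  assume \<tau>: "\<tau> \<longlonglongrightarrow> 0"
  interpret D: real_distribution "distr M borel X" by simp
  show ?thesis
    using isCont_tendsto_compose[OF D.isCont_char \<tau>]
    by (simp only: D.char_zero) (simp only: char_eq_mchar)
qed

text \<open>For each \<omega>, \<open>3 (1 - cos (\<tau> X)) / \<tau>^2\<close> eventually dominates
  \<open>X^2\<close>, by \<open>one_minus_cos_ge\<close>. Its mean is at most \<open>3 * C\<close>,
  so Fatou's lemma bounds the second moment, even though the hypothesis concerns a single sequence
  of arguments.\<close>

lemma second_moment_finite_if_quadratic_chf:
  assumes \<tau>: "\<tau> \<longlonglongrightarrow> 0" "\<And>k. \<tau> k \<noteq> 0"
    and bd: "eventually (\<lambda>k. 1 - Re (chf (\<tau> k)) \<le> C * (\<tau> k)\<^sup>2) sequentially"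
  shows "second_moment M X < \<infinity>"
proof -
  let ?u = "\<lambda>k \<omega>. ennreal (3 / (\<tau> k)\<^sup>2 * (1 - cos (\<tau> k * X \<omega>)))"
  have "ennreal ((X \<omega>)\<^sup>2) \<le> liminf (\<lambda>k. ?u k \<omega>)" for \<omega>
  proof (rule Liminf_bounded)
    have "(\<lambda>k. \<bar>\<tau> k * X \<omega>\<bar>) \<longlonglongrightarrow> \<bar>0 * X \<omega>\<bar>" by (intro tendsto_intros \<tau>)
    then have "eventually (\<lambda>k. \<bar>\<tau> k * X \<omega>\<bar> < 1) sequentially" by (intro order_tendstoD(2)) auto
    then show "eventually (\<lambda>k. ennreal ((X \<omega>)\<^sup>2) \<le> ?u k \<omega>) sequentially"
    proof eventually_elim
      case (elim k)
      show ?case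
        using one_minus_cos_ge[of "\<tau> k * X \<omega>"] elim \<tau>(2)[of k]
        by (intro ennreal_leI) (simp add: field_simps power_mult_distrib)
    qed
  qed
  then have "second_moment M X \<le> (\<integral>\<^sup>+\<omega>. liminf (\<lambda>k. ?u k \<omega>) \<partial>M)"
    unfolding second_moment_def by (intro nn_integral_mono) auto
  also have "\<dots> \<le> liminf (\<lambda>k. \<integral>\<^sup>+\<omega>. ?u k \<omega> \<partial>M)"
    by (rule nn_integral_liminf) measurable
  also have "\<dots> \<le> liminf (\<lambda>k::nat. ennreal (3 * C))"
  proof (rule Liminf_mono)
    show "eventually (\<lambda>k. (\<integral>\<^sup>+\<omega>. ?u k \<omega> \<partial>M) \<le> ennreal (3 * C)) sequentially"
      using bd
    proof eventually_elim
      case (elim k)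
      have "(\<integral>\<^sup>+\<omega>. ?u k \<omega> \<partial>M) = ennreal (expectation (\<lambda>\<omega>. 3 / (\<tau> k)\<^sup>2 * (1 - cos (\<tau> k * X \<omega>))))"
        by (intro nn_integral_eq_integral integrable_mult_right Bochner_Integration.integrable_diff
            integrable_bounded_trig AE_I2 mult_nonneg_nonneg) auto
      also have "expectation (\<lambda>\<omega>. 3 / (\<tau> k)\<^sup>2 * (1 - cos (\<tau> k * X \<omega>))) = 3 / (\<tau> k)\<^sup>2 * (1 - Re (chf (\<tau> k)))"
        by (simp add: Re_chf integrable_bounded_trig prob_space)
      also have "\<dots> \<le> 3 * C" using elim \<tau>(2)[of k] by (simp add: field_simps)
      finally show ?case by (simp add: ennreal_leI)
    qed
  qed
  also have "\<dots> = ennreal (3 * C)" by (simp add: Liminf_const)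
  finally show ?thesis by (simp add: le_less_trans)
qed

end

end

section \<open>Norming constants under infinite variance\<close>

context prob_space
begin

context
  fixes X :: "'a \<Rightarrow> real"
  assumes X [measurable]: "X \<in> borel_measurable M"
begin

lemma exists_small_tail:
  assumes "\<epsilon> > 0"
  obtains K where "K \<ge> 0" "tail X K < \<epsilon>"
proof -
  have "eventually (\<lambda>k::nat. tail X (real k) < \<epsilon>) sequentially"
    using order_tendstoD(2)[OF tail_tendsto_0[OF X] assms] .
  then obtain k :: nat where "tail X (real k) < \<epsilon>" by (auto simp: eventually_sequentially)
  then show thesis by (intro that[of "real k"]) auto
qed

text \<open>
  If \<open>sqrt n \<ge> e * b n\<close> along a subsequence, then the arguments \<open>s n = e * b n / sqrt n\<close> are bounded
  there, so the characteristic function of \<open>X\<close> at \<open>e / sqrt n\<close> is \<open>1 - O(1 / n)\<close>, and Fatou's lemma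
  gives a finite second moment.
\<close>

lemma DAN_infinite_variance_norming:
  assumes inf: "second_moment M X = \<infinity>" and b: "\<And>n. b n > 0"
    and conv: "\<And>(s :: nat \<Rightarrow> real) s' q. s \<longlonglongrightarrow> s' \<Longrightarrow> strict_mono q \<Longrightarrow>
      (\<lambda>k. cis (- (s k / b (q k) * a (q k))) * chf X (s k / b (q k)) ^ q k)
      \<longlonglongrightarrow> complex_of_real (exp (- s'\<^sup>2 / 2))"
  shows "(\<lambda>n. sqrt (real n) / b n) \<longlonglongrightarrow> 0"
proof (rule ccontr)
  assume "\<not> ?thesis"
  then obtain e where e: "e > 0" "\<And>N. \<exists>n\<ge>N. \<not> dist (sqrt (real n) / b n) 0 < e"
    unfolding tendsto_iff eventually_sequentially by blast
  then have "infinite {n. \<not> dist (sqrt (real n) / b n) 0 < e}"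
    by (auto simp: infinite_nat_iff_unbounded_le)
  from infinite_enumerate[OF this] obtain r :: "nat \<Rightarrow> nat"
    where r: "strict_mono r" "\<And>k. \<not> dist (sqrt (real (r k)) / b (r k)) 0 < e" by auto
  have rk: "sqrt (real (r k)) \<ge> e * b (r k)" for k
    using r(2)[of k] b[of "r k"] by (simp add: field_simps not_less)
  have rpos: "r k > 0" for k
    using rk[of k] mult_pos_pos[OF e(1) b[of "r k"]] by (cases "r k = 0") auto
  define t where "t k = e * b (r k) / sqrt (real (r k))" for k
  have "t k \<in> {0..1}" for k
    using rk[of k] rpos[of k] e(1) b[of "r k"] by (auto simp: t_def)
  \<comment> \<open>\<open>conv\<close> requires convergent arguments, which compactness supplies.
    The limit \<open>t0\<close> may be 0: only the positivity of \<open>exp (- t0^2 / 2)\<close> is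
    used.\<close>
  then obtain t0 and p :: "nat \<Rightarrow> nat" where t0: "strict_mono p" "(t \<circ> p) \<longlonglongrightarrow> t0"
    using compact_Icc[of "0::real" 1] unfolding compact_def by metis
  define q where "q = r \<circ> p"
  have q: "strict_mono q" unfolding q_def by (rule strict_mono_o[OF r(1) t0(1)])
  have qpos: "q k > 0" for k by (simp add: q_def rpos)
  define \<tau> where "\<tau> k = e / sqrt (real (q k))" for k
  have \<tau>: "(t \<circ> p) k / b (q k) = \<tau> k" for k
    using b[of "q k"] by (simp add: t_def \<tau>_def q_def)
  have "filterlim q at_top sequentially" by (rule filterlim_subseq[OF q])
  then have "filterlim (\<lambda>k. sqrt (real (q k))) at_top sequentially"
    by (intro filterlim_compose[OF sqrt_at_top] filterlim_compose[OF filterlim_real_sequentially])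
  then have \<tau>0: "\<tau> \<longlonglongrightarrow> 0"
    unfolding \<tau>_def by (intro tendsto_divide_0[OF tendsto_const] filterlim_at_top_imp_at_infinity)
  have \<tau>_ne: "\<tau> k \<noteq> 0" for k using e(1) qpos[of k] by (simp add: \<tau>_def)
  have "(\<lambda>k. norm (chf X (\<tau> k)) ^ q k) \<longlonglongrightarrow> exp (- t0\<^sup>2 / 2)"
    using tendsto_norm[OF conv[OF t0(2) q]] unfolding \<tau> by (simp add: norm_mult norm_power)
  from power_limit_imp_bound[OF this] obtain C where
    C: "eventually (\<lambda>k. real (q k) * (1 - (norm (chf X (\<tau> k)))\<^sup>2) \<le> C) sequentially" by auto
  obtain K where K: "K \<ge> 0" "tail X K < 1 / 8" using exists_small_tail[of "1 / 8"] by auto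
  have "(\<lambda>k. Re (chf X (\<tau> k))) \<longlonglongrightarrow> Re 1"
    by (intro tendsto_Re chf_tendsto_1 X \<tau>0)
  then have "eventually (\<lambda>k. Re (chf X (\<tau> k)) > 0) sequentially"
    by (rule order_tendstoD) simp
  \<comment> \<open>Since \<open>1 / q k = (\<tau> k)^2 / e^2\<close>, a bound of order
    \<open>1 / q k\<close> is quadratic in \<open>\<tau> k\<close>; this explains the first
    constant.\<close>
  with C have "eventually (\<lambda>k. 1 - Re (chf X (\<tau> k)) \<le> (2 * C / e\<^sup>2 + 4 * K\<^sup>2) * (\<tau> k)\<^sup>2) sequentially"
  proof eventually_elim
    case (elim k)
    have \<tau>2: "(\<tau> k)\<^sup>2 = e\<^sup>2 / real (q k)" by (simp add: \<tau>_def power_divide)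
    have "1 - (norm (chf X (\<tau> k)))\<^sup>2 \<le> C / real (q k)" using elim(1) qpos[of k] by (simp add: field_simps)
    then have "2 * (1 - (norm (chf X (\<tau> k)))\<^sup>2) \<le> 2 * C / e\<^sup>2 * (\<tau> k)\<^sup>2"
      using e(1) by (simp add: \<tau>2)
    then show ?case
      using one_minus_Re_chf_le[OF X K(1), of "\<tau> k"] K(2) elim(2)
      unfolding distrib_right by linarith
  qed
  from second_moment_finite_if_quadratic_chf[OF X \<tau>0 \<tau>_ne this] inf show False by simp
qed

text \<open>Use \<open>|cis y - 1| \<le> |sin y| + (1 - cos y)\<close>. The modulus bound makes
  \<open>n (1 - Re chf)\<close> bounded, so the cosine part is even \<open>O(1 / n)\<close>. The
  sine part needs \<open>expectation_abs_sin_le\<close>, where one term is killed by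
  \<open>sqrt n / b n\<close> tending to 0 and the other by a large truncation level.\<close>

lemma DAN_infinite_variance_cis:
  assumes inf: "second_moment M X = \<infinity>" and b: "\<And>n. b n > 0"
    and conv: "\<And>(s :: nat \<Rightarrow> real) s' q. s \<longlonglongrightarrow> s' \<Longrightarrow> strict_mono q \<Longrightarrow>
      (\<lambda>k. cis (- (s k / b (q k) * a (q k))) * chf X (s k / b (q k)) ^ q k)
      \<longlonglongrightarrow> complex_of_real (exp (- s'\<^sup>2 / 2))"
  shows "(\<lambda>n. sqrt (real n) * expectation (\<lambda>\<omega>. norm (cis (s / b n * X \<omega>) - 1))) \<longlonglongrightarrow> 0"
proof -
  define \<rho> where "\<rho> n = sqrt (real n) / b n" for n
  have \<rho>0: "\<rho> \<longlonglongrightarrow> 0" unfolding \<rho>_def by (rule DAN_infinite_variance_norming[OF assms])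
  define \<tau> where "\<tau> n = s / b n" for n
  have n\<tau>: "real n * (\<tau> n)\<^sup>2 = s\<^sup>2 * (\<rho> n)\<^sup>2" for n
    by (simp add: \<tau>_def \<rho>_def power_divide)
  have \<tau>0: "\<tau> \<longlonglongrightarrow> 0"
  proof (rule Lim_null_comparison)
    have "eventually (\<lambda>n::nat. n \<ge> 1) sequentially" by (rule eventually_ge_at_top)
    then show "eventually (\<lambda>n. norm (\<tau> n) \<le> \<bar>s\<bar> * \<rho> n) sequentially"
    proof eventually_elim
      case (elim n)
      then have "\<bar>s\<bar> * 1 \<le> \<bar>s\<bar> * sqrt (real n)" by (intro mult_left_mono) auto
      then show ?case using b[of n] by (simp add: \<tau>_def \<rho>_def divide_right_mono)
    qed
    show "(\<lambda>n. \<bar>s\<bar> * \<rho> n) \<longlonglongrightarrow> 0" using tendsto_mult[OF tendsto_const \<rho>0] by simp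
  qed
  have "(\<lambda>n. norm (chf X (\<tau> n)) ^ n) \<longlonglongrightarrow> exp (- s\<^sup>2 / 2)"
    using tendsto_norm[OF conv[OF tendsto_const strict_mono_id, of s]]
    by (simp add: norm_mult norm_power \<tau>_def)
  from power_limit_imp_bound[OF this] obtain C where
    C: "eventually (\<lambda>n. real n * (1 - (norm (chf X (\<tau> n)))\<^sup>2) \<le> C) sequentially" by auto
  obtain K where K: "K \<ge> 0" "tail X K < 1 / 8" using exists_small_tail[of "1 / 8"] by auto
  have "(\<lambda>n. Re (chf X (\<tau> n))) \<longlonglongrightarrow> Re 1"
    by (intro tendsto_Re chf_tendsto_1 X \<tau>0)
  then have "eventually (\<lambda>n. Re (chf X (\<tau> n)) > 0) sequentially"
    by (rule order_tendstoD) simp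
  moreover have "eventually (\<lambda>n. \<rho> n < 1) sequentially" by (rule order_tendstoD(2)[OF \<rho>0]) simp
  ultimately have ev: "eventually (\<lambda>n. real n * (1 - Re (chf X (\<tau> n))) \<le> 2 * C + 4 * K\<^sup>2 * s\<^sup>2) sequentially"
    using C
  proof eventually_elim
    case (elim n)
    have \<rho>n: "(\<rho> n)\<^sup>2 \<le> 1" using elim(2) b[of n] by (auto simp: abs_square_le_1 \<rho>_def)
    have "real n * (1 - Re (chf X (\<tau> n))) \<le> real n * (2 * (1 - (norm (chf X (\<tau> n)))\<^sup>2) + 4 * K\<^sup>2 * (\<tau> n)\<^sup>2)"
      using one_minus_Re_chf_le[OF X K(1), of "\<tau> n"] K(2) elim(1) by (intro mult_left_mono) auto
    also have "\<dots> = 2 * (real n * (1 - (norm (chf X (\<tau> n)))\<^sup>2)) + 4 * K\<^sup>2 * (real n * (\<tau> n)\<^sup>2)"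
      by (simp add: algebra_simps)
    also have "\<dots> \<le> 2 * C + 4 * K\<^sup>2 * (s\<^sup>2 * 1)"
      unfolding n\<tau> using elim(3) \<rho>n by (intro add_mono mult_left_mono) auto
    finally show ?case by simp
  qed
  \<comment> \<open>The maximum with 1 makes the bound positive, so that one can divide by
    it.\<close>
  define D where "D = max 1 (2 * C + 4 * K\<^sup>2 * s\<^sup>2)"
  have D: "D > 0" "eventually (\<lambda>n. real n * (1 - Re (chf X (\<tau> n))) \<le> D) sequentially"
    using eventually_mono[OF ev] by (auto simp: D_def)
  define S where "S n = expectation (\<lambda>\<omega>. \<bar>sin (\<tau> n * X \<omega>)\<bar>)" for n
  have "(\<lambda>n. real n * (S n)\<^sup>2) \<longlonglongrightarrow> 0"
  proof (rule LIMSEQ_I)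
    fix \<epsilon> :: real assume \<epsilon>: "\<epsilon> > 0"
    \<comment> \<open>The level \<open>L\<close> is fixed before \<open>n\<close>: the choice gives
      \<open>4 * tail X L * D \<le> \<epsilon> / 2\<close>, after which the term in
      \<open>L^2 \<rho>^2\<close> is made small by large \<open>n\<close>.\<close>
    then obtain L where L: "L \<ge> 0" "tail X L < \<epsilon> / (8 * D)"
      using exists_small_tail[of "\<epsilon> / (8 * D)"] D(1) by auto
    have tail0: "tail X L \<ge> 0" by (rule Bochner_Integration.integral_nonneg) simp
    have "(\<lambda>n. 2 * L\<^sup>2 * (s\<^sup>2 * (\<rho> n)\<^sup>2)) \<longlonglongrightarrow> 2 * L\<^sup>2 * (s\<^sup>2 * 0\<^sup>2)" by (intro tendsto_intros \<rho>0)
    then have "eventually (\<lambda>n. 2 * L\<^sup>2 * (s\<^sup>2 * (\<rho> n)\<^sup>2) < \<epsilon> / 2) sequentially"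
      by (rule order_tendstoD(2)) (use \<epsilon> in simp)
    with D(2) have "eventually (\<lambda>n. norm (real n * (S n)\<^sup>2 - 0) < \<epsilon>) sequentially"
    proof eventually_elim
      case (elim n)
      have "real n * (S n)\<^sup>2 \<le> real n * (2 * L\<^sup>2 * (\<tau> n)\<^sup>2 + 4 * tail X L * (1 - Re (chf X (\<tau> n))))"
        unfolding S_def by (intro mult_left_mono expectation_abs_sin_le X L) auto
      also have "\<dots> = 2 * L\<^sup>2 * (s\<^sup>2 * (\<rho> n)\<^sup>2) + 4 * tail X L * (real n * (1 - Re (chf X (\<tau> n))))"
        unfolding n\<tau>[symmetric] by (simp add: algebra_simps)
      also have "\<dots> \<le> 2 * L\<^sup>2 * (s\<^sup>2 * (\<rho> n)\<^sup>2) + 4 * tail X L * D"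
        using elim(1) tail0 by (intro add_left_mono mult_left_mono) auto
      also have "4 * tail X L * D \<le> \<epsilon> / 2" using L(2) D(1) by (simp add: field_simps)
      finally show ?case using elim(2) by simp
    qed
    then show "\<exists>no. \<forall>n\<ge>no. norm (real n * (S n)\<^sup>2 - 0) < \<epsilon>" by (simp add: eventually_sequentially)
  qed
  from tendsto_real_sqrt[OF this]
  have "(\<lambda>n. sqrt (real n) * S n) \<longlonglongrightarrow> 0"
    by (simp add: real_sqrt_mult S_def Bochner_Integration.integral_nonneg)
  moreover have "(\<lambda>n. sqrt (real n) * (1 - Re (chf X (\<tau> n)))) \<longlonglongrightarrow> 0"
  proof (rule Lim_null_comparison)
    have "eventually (\<lambda>n::nat. n \<ge> 1) sequentially" by (rule eventually_ge_at_top)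
    with D(2) show "eventually (\<lambda>n. norm (sqrt (real n) * (1 - Re (chf X (\<tau> n)))) \<le> D / sqrt (real n)) sequentially"
    proof eventually_elim
      case (elim n)
      have "1 - Re (chf X (\<tau> n)) \<ge> 0"
        using norm_mchar_le_1[OF borel_prob_distr[OF prob_space_axioms X], of "\<tau> n"]
          complex_Re_le_cmod[of "chf X (\<tau> n)"] by linarith
      moreover have "sqrt (real n) * (1 - Re (chf X (\<tau> n))) \<le> D / sqrt (real n)"
      proof -
        have n: "sqrt (real n) > 0" using elim(2) by simp
        have "sqrt (real n) * (1 - Re (chf X (\<tau> n))) * sqrt (real n) = real n * (1 - Re (chf X (\<tau> n)))"
          by simp
        then show ?thesis using elim(1) by (simp only: pos_le_divide_eq[OF n])
      qed
      ultimately show ?case by (simp add: abs_mult)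
    qed
    show "(\<lambda>n. D / sqrt (real n)) \<longlonglongrightarrow> 0"
      by (intro tendsto_divide_0[OF tendsto_const] filterlim_at_top_imp_at_infinity
          filterlim_compose[OF sqrt_at_top] filterlim_real_sequentially)
  qed
  ultimately have lim: "(\<lambda>n. sqrt (real n) * S n + sqrt (real n) * (1 - Re (chf X (\<tau> n)))) \<longlonglongrightarrow> 0"
    using tendsto_add by fastforce
  show ?thesis
  proof (rule Lim_null_comparison[OF always_eventually lim], rule allI)
    fix n
    have "norm (cis y - 1) \<le> \<bar>sin y\<bar> + (1 - cos y)" for y
      using cmod_le[of "cis y - 1"] by simp
    then have "expectation (\<lambda>\<omega>. norm (cis (\<tau> n * X \<omega>) - 1)) \<le>
      expectation (\<lambda>\<omega>. \<bar>sin (\<tau> n * X \<omega>)\<bar> + (1 - cos (\<tau> n * X \<omega>)))"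
      by (intro integral_mono Bochner_Integration.integrable_add Bochner_Integration.integrable_diff
          integrable_norm integrable_cis integrable_bounded_trig X) auto
    also have "\<dots> = S n + (1 - Re (chf X (\<tau> n)))"
      unfolding S_def Re_chf[OF X]
      by (simp add: integrable_bounded_trig prob_space)
    finally have "sqrt (real n) * expectation (\<lambda>\<omega>. norm (cis (\<tau> n * X \<omega>) - 1)) \<le>
      sqrt (real n) * (S n + (1 - Re (chf X (\<tau> n))))"
      by (intro mult_left_mono) auto
    moreover have "expectation (\<lambda>\<omega>. norm (cis (\<tau> n * X \<omega>) - 1)) \<ge> 0"
      by (rule Bochner_Integration.integral_nonneg) simp
    ultimately show "norm (sqrt (real n) * expectation (\<lambda>\<omega>. norm (cis (s / b n * X \<omega>) - 1))) \<le>
      sqrt (real n) * S n + sqrt (real n) * (1 - Re (chf X (\<tau> n)))"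
      unfolding \<tau>_def[symmetric] by (simp add: distrib_left abs_mult)
  qed
qed

end

end

subsection \<open>Asymptotic factorisation and the block of finite variances\<close>

text \<open>The family is extended one index at a time. The functionals
  \<open>\<beta> x (v i)\<close> are represented as \<open>x \<bullet> g i\<close>; fewer than
  \<open>CARD('d)\<close> vectors \<open>g i\<close> lie in a hyperplane, whose normal is
  \<beta>-orthogonal to all earlier \<open>v i\<close> and only has to be scaled. Indexing by
  \<open>'d\<close> lets the vectors become the rows of a matrix.\<close>

lemma exists_orthonormal_for_bilinear:
  fixes \<beta> :: "real ^ 'd \<Rightarrow> real ^ 'd \<Rightarrow> real"
  assumes bil: "bilinear \<beta>" and sym: "\<And>x y. \<beta> x y = \<beta> y x" and pos: "\<And>x. x \<noteq> 0 \<Longrightarrow> \<beta> x x > 0"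
  obtains v :: "'d \<Rightarrow> real ^ 'd" where "\<And>i j. \<beta> (v i) (v j) = of_bool (i = j)"
proof -
  have lin: "linear (\<lambda>x. \<beta> x y)" "linear (\<lambda>x. \<beta> y x)" for y
    using bil by (auto simp: bilinear_def)
  have "\<exists>v :: 'd \<Rightarrow> real ^ 'd. \<forall>i\<in>A. \<forall>j\<in>A. \<beta> (v i) (v j) = of_bool (i = j)" for A
  proof (induction A rule: infinite_finite_induct)
    case (insert a A)
    then obtain v where v: "\<And>i j. i \<in> A \<Longrightarrow> j \<in> A \<Longrightarrow> \<beta> (v i) (v j) = of_bool (i = j)" by blast
    define g where "g i = adjoint (\<lambda>x. \<beta> x (v i)) (1::real)" for i
    have g: "x \<bullet> g i = \<beta> x (v i)" for x i
      using adjoint_works[OF lin(1)[of "v i"], of x 1] by (simp add: g_def)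
    have "dim (g ` A) \<le> card (g ` A)" using insert(1) by (intro dim_le_card') simp
    also have "\<dots> \<le> card A" by (rule card_image_le) fact
    also have "\<dots> < CARD('d)" using insert(1,2) by (intro psubset_card_mono) auto
    finally have "dim (g ` A) < DIM(real ^ 'd)" by simp
    from lowdim_subset_hyperplane[OF this] obtain x where
      x: "x \<noteq> 0" "span (g ` A) \<subseteq> {y. x \<bullet> y = 0}" by blast
    have x0: "\<beta> x (v i) = 0" if "i \<in> A" for i
      using x(2) span_base[of "g i" "g ` A"] that by (auto simp: g[symmetric])
    define y where "y = x /\<^sub>R sqrt (\<beta> x x)"
    have yz: "\<beta> y z = \<beta> x z / sqrt (\<beta> x x)" "\<beta> z y = \<beta> z x / sqrt (\<beta> x x)" for z
      unfolding y_def using linear_cmul[OF lin(1)] linear_cmul[OF lin(2)] by (simp_all add: divide_inverse mult.commute)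
    have yy: "\<beta> y y = 1" using pos[OF x(1)] by (simp add: yz)
    have yv: "\<beta> y (v i) = 0" "\<beta> (v i) y = 0" if "i \<in> A" for i
      using x0[OF that] sym[of "v i" x] by (simp_all add: yz)
    show ?case
      by (rule exI[of _ "v(a := y)"]) (use insert(2) v yy yv in auto)
  qed auto
  from this[of UNIV] show thesis using that by auto
qed

context prob_space
begin

text \<open>
  The factors are split off one at a time: for unimodular \<open>P\<close> and \<open>e\<close>,
  \<open>E (P * e) - E P * E e = E ((P - 1) * (e - 1)) - E (P - 1) * E (e - 1)\<close>.
\<close>

lemma expectation_prod_cis_factor:
  fixes e :: "nat \<Rightarrow> 'i \<Rightarrow> 'a \<Rightarrow> complex"
  assumes meas [measurable]: "\<And>n j. e n j \<in> borel_measurable M" and unit: "\<And>n j \<omega>. norm (e n j \<omega>) = 1"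
    and "finite J" "finite A" "J \<inter> A = {}"
    and cross: "\<And>j k. j \<in> J \<union> A \<Longrightarrow> k \<in> A \<Longrightarrow> j \<noteq> k \<Longrightarrow>
      (\<lambda>n. real n * expectation (\<lambda>\<omega>. norm (e n j \<omega> - 1) * norm (e n k \<omega> - 1))) \<longlonglongrightarrow> 0"
    and mean: "\<And>j k. j \<in> J \<union> A \<Longrightarrow> k \<in> A \<Longrightarrow> j \<noteq> k \<Longrightarrow>
      (\<lambda>n. real n * (expectation (\<lambda>\<omega>. norm (e n j \<omega> - 1)) * expectation (\<lambda>\<omega>. norm (e n k \<omega> - 1)))) \<longlonglongrightarrow> 0"
  shows "(\<lambda>n. real n * norm (expectation (\<lambda>\<omega>. \<Prod>j\<in>J \<union> A. e n j \<omega>) -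
    expectation (\<lambda>\<omega>. \<Prod>j\<in>J. e n j \<omega>) * (\<Prod>k\<in>A. expectation (e n k)))) \<longlonglongrightarrow> 0"
  using assms(4,5) cross mean
proof (induction A rule: finite_induct)
  case empty
  then show ?case by simp
next
  case (insert k A)
  note fin = \<open>finite J\<close> \<open>finite A\<close>
  have k: "k \<notin> J \<union> A" using insert.hyps insert.prems(1) by auto
  define d where "d n j \<omega> = norm (e n j \<omega> - 1)" for n j \<omega>
  have d_meas [measurable]: "d n j \<in> borel_measurable M" for n j unfolding d_def by measurable
  have d2: "d n j \<omega> \<le> 2" for n j \<omega>
    using norm_triangle_ineq4[of "e n j \<omega>" 1] by (simp add: d_def unit)
  have d0: "d n j \<omega> \<ge> 0" for n j \<omega> by (simp add: d_def)
  have d_int: "integrable M (d n j)" for n j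
    by (rule integrable_const_bound[where B=2]) (auto simp: d2 d0)
  have dd4: "d n i \<omega> * d n j \<omega> \<le> 2 * 2" for n i j \<omega>
    by (intro mult_mono d2 d0) simp
  have dd_int: "integrable M (\<lambda>\<omega>. d n i \<omega> * d n j \<omega>)" for n i j
    by (rule integrable_const_bound[where B="2*2"]) (use dd4 in \<open>auto simp: abs_mult d0\<close>)
  define P where "P n \<omega> = (\<Prod>j\<in>J \<union> A. e n j \<omega>)" for n \<omega>
  have P_meas [measurable]: "P n \<in> borel_measurable M" for n unfolding P_def by measurable
  have P1: "norm (P n \<omega>) = 1" for n \<omega> by (simp add: P_def prod_norm[symmetric] unit)
  have P_int: "integrable M (P n)" for n by (rule integrable_const_bound[where B=1]) (auto simp: P1)
  have e_int: "integrable M (e n j)" for n j by (rule integrable_const_bound[where B=1]) (auto simp: unit)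
  have Pe_int: "integrable M (\<lambda>\<omega>. P n \<omega> * e n j \<omega>)" for n j
    by (rule integrable_const_bound[where B=1]) (auto simp: unit P1 norm_mult)
  \<comment> \<open>Replacing the unimodular factors by 1 one after another telescopes, each
    replacement costing one \<open>d n j\<close>.\<close>
  have Pd: "norm (P n \<omega> - 1) \<le> (\<Sum>j\<in>J \<union> A. d n j \<omega>)" for n \<omega>
    using norm_prod_diff[of "J \<union> A" "\<lambda>j. e n j \<omega>" "\<lambda>_. 1"] by (simp add: P_def d_def unit)
  define Q where "Q n = expectation (\<lambda>\<omega>. \<Prod>j\<in>J. e n j \<omega>) * (\<Prod>k\<in>A. expectation (e n k))" for n
  have IH: "(\<lambda>n. real n * norm (expectation (P n) - Q n)) \<longlonglongrightarrow> 0"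
    using insert.IH insert.prems unfolding P_def Q_def by auto
  define R where "R n = (\<Sum>j\<in>J \<union> A. real n * expectation (\<lambda>\<omega>. d n j \<omega> * d n k \<omega>)) +
    (\<Sum>j\<in>J \<union> A. real n * (expectation (d n j) * expectation (d n k)))" for n
  have "R \<longlonglongrightarrow> 0"
    unfolding R_def d_def
    by (intro tendsto_add_zero tendsto_null_sum insert.prems) (use k in auto)
  have bound: "real n * norm (expectation (\<lambda>\<omega>. P n \<omega> * e n k \<omega>) - expectation (P n) * expectation (e n k)) \<le> R n" for n
  proof -
    let ?S = "\<lambda>\<omega>. \<Sum>j\<in>J \<union> A. d n j \<omega>"
    have "norm (P n \<omega> - 1) * norm (e n k \<omega> - 1) \<le> 2 * 2" for \<omega>
      using norm_triangle_ineq4[of "P n \<omega>" 1] norm_triangle_ineq4[of "e n k \<omega>" 1]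
      by (intro mult_mono) (auto simp: P1 unit)
    then have cov_int: "integrable M (\<lambda>\<omega>. (P n \<omega> - 1) * (e n k \<omega> - 1))"
      by (intro integrable_const_bound[where B="2*2"] AE_I2) (simp only: norm_mult, measurable)
    have "expectation (\<lambda>\<omega>. (P n \<omega> - 1) * (e n k \<omega> - 1)) =
      expectation (\<lambda>\<omega>. P n \<omega> * e n k \<omega> - P n \<omega> - e n k \<omega> + 1)"
      by (simp add: algebra_simps)
    also have "\<dots> = expectation (\<lambda>\<omega>. P n \<omega> * e n k \<omega>) - expectation (P n) - expectation (e n k) + 1"
      by (simp add: Pe_int P_int e_int prob_space)
    finally have "expectation (\<lambda>\<omega>. P n \<omega> * e n k \<omega>) - expectation (P n) * expectation (e n k) =
      expectation (\<lambda>\<omega>. (P n \<omega> - 1) * (e n k \<omega> - 1)) - expectation (\<lambda>\<omega>. P n \<omega> - 1) * expectation (\<lambda>\<omega>. e n k \<omega> - 1)"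
      by (simp add: P_int e_int prob_space algebra_simps)
    also have "norm \<dots> \<le> norm (expectation (\<lambda>\<omega>. (P n \<omega> - 1) * (e n k \<omega> - 1))) +
      norm (expectation (\<lambda>\<omega>. P n \<omega> - 1)) * norm (expectation (\<lambda>\<omega>. e n k \<omega> - 1))"
      using norm_triangle_ineq4 by (simp add: norm_mult[symmetric])
    also have "\<dots> \<le> expectation (\<lambda>\<omega>. ?S \<omega> * d n k \<omega>) + expectation ?S * expectation (d n k)"
    proof (intro add_mono mult_mono)
      have "norm (expectation (\<lambda>\<omega>. (P n \<omega> - 1) * (e n k \<omega> - 1))) \<le>
        expectation (\<lambda>\<omega>. norm ((P n \<omega> - 1) * (e n k \<omega> - 1)))" by (rule integral_norm_bound)
      also have "\<dots> \<le> expectation (\<lambda>\<omega>. ?S \<omega> * d n k \<omega>)"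
      proof (rule integral_mono)
        show "integrable M (\<lambda>\<omega>. norm ((P n \<omega> - 1) * (e n k \<omega> - 1)))"
          by (rule integrable_norm[OF cov_int])
        show "integrable M (\<lambda>\<omega>. ?S \<omega> * d n k \<omega>)"
          unfolding sum_distrib_right by (intro Bochner_Integration.integrable_sum dd_int)
        fix \<omega>
        show "norm ((P n \<omega> - 1) * (e n k \<omega> - 1)) \<le> ?S \<omega> * d n k \<omega>"
          unfolding norm_mult d_def[of n k \<omega>, symmetric] by (intro mult_right_mono Pd d0)
      qed
      finally show "norm (expectation (\<lambda>\<omega>. (P n \<omega> - 1) * (e n k \<omega> - 1))) \<le> expectation (\<lambda>\<omega>. ?S \<omega> * d n k \<omega>)" .
      have "norm (expectation (\<lambda>\<omega>. P n \<omega> - 1)) \<le> expectation (\<lambda>\<omega>. norm (P n \<omega> - 1))"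
        by (rule integral_norm_bound)
      also have "\<dots> \<le> expectation ?S"
        using P_int d_int Pd by (intro integral_mono) auto
      finally show "norm (expectation (\<lambda>\<omega>. P n \<omega> - 1)) \<le> expectation ?S" .
      show "norm (expectation (\<lambda>\<omega>. e n k \<omega> - 1)) \<le> expectation (d n k)"
        unfolding d_def by (rule integral_norm_bound)
      show "0 \<le> expectation ?S" by (rule Bochner_Integration.integral_nonneg) (auto intro: sum_nonneg d0)
    qed auto
    also have "expectation (\<lambda>\<omega>. ?S \<omega> * d n k \<omega>) = (\<Sum>j\<in>J \<union> A. expectation (\<lambda>\<omega>. d n j \<omega> * d n k \<omega>))"
      unfolding sum_distrib_right by (rule Bochner_Integration.integral_sum) (rule dd_int)
    also have "expectation ?S = (\<Sum>j\<in>J \<union> A. expectation (d n j))"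
      by (rule Bochner_Integration.integral_sum) (rule d_int)
    finally show ?thesis
      using mult_left_mono[of _ _ "real n"]
      unfolding R_def by (simp add: sum_distrib_left[symmetric] sum_distrib_right[symmetric] distrib_left[symmetric])
  qed
  show ?case
  proof (rule Lim_null_comparison)
    show "(\<lambda>n. R n + real n * norm (expectation (P n) - Q n)) \<longlonglongrightarrow> 0"
      using tendsto_add[OF \<open>R \<longlonglongrightarrow> 0\<close> IH] by simp
    show "eventually (\<lambda>n. norm (real n * norm (expectation (\<lambda>\<omega>. \<Prod>j\<in>J \<union> insert k A. e n j \<omega>) -
      expectation (\<lambda>\<omega>. \<Prod>j\<in>J. e n j \<omega>) * (\<Prod>k\<in>insert k A. expectation (e n k)))) \<le>
      R n + real n * norm (expectation (P n) - Q n)) sequentially"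
    proof (rule always_eventually, rule allI)
      fix n
      have full: "(\<Prod>j\<in>J \<union> insert k A. e n j \<omega>) = P n \<omega> * e n k \<omega>" for \<omega>
        using k fin by (simp add: P_def mult.commute)
      have Qk: "expectation (\<lambda>\<omega>. \<Prod>j\<in>J. e n j \<omega>) * (\<Prod>k\<in>insert k A. expectation (e n k)) = Q n * expectation (e n k)"
        using insert.hyps by (simp add: Q_def mult_ac)
      have ek: "norm (expectation (e n k)) \<le> 1"
        using integral_norm_bound[of M "e n k"] by (simp add: unit prob_space)
      \<comment> \<open>The total error is the new covariance, bounded by \<open>R n\<close>, plus
        the error of the induction hypothesis times a mean of modulus at most 1.\<close>
      have eq: "expectation (\<lambda>\<omega>. P n \<omega> * e n k \<omega>) - Q n * expectation (e n k) =
        (expectation (\<lambda>\<omega>. P n \<omega> * e n k \<omega>) - expectation (P n) * expectation (e n k)) +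
        (expectation (P n) - Q n) * expectation (e n k)"
        by (simp add: algebra_simps)
      have "norm (expectation (\<lambda>\<omega>. P n \<omega> * e n k \<omega>) - Q n * expectation (e n k)) \<le>
        norm (expectation (\<lambda>\<omega>. P n \<omega> * e n k \<omega>) - expectation (P n) * expectation (e n k)) +
        norm (expectation (P n) - Q n) * norm (expectation (e n k))"
        unfolding eq norm_mult[symmetric] by (rule norm_triangle_ineq)
      also have "\<dots> \<le> norm (expectation (\<lambda>\<omega>. P n \<omega> * e n k \<omega>) - expectation (P n) * expectation (e n k)) +
        norm (expectation (P n) - Q n)"
        using ek by (simp add: mult_left_le)
      finally have "real n * norm (expectation (\<lambda>\<omega>. P n \<omega> * e n k \<omega>) - Q n * expectation (e n k)) \<le>
        real n * (norm (expectation (\<lambda>\<omega>. P n \<omega> * e n k \<omega>) - expectation (P n) * expectation (e n k)) +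
        norm (expectation (P n) - Q n))"
        by (intro mult_left_mono) auto
      then show "norm (real n * norm (expectation (\<lambda>\<omega>. \<Prod>j\<in>J \<union> insert k A. e n j \<omega>) -
        expectation (\<lambda>\<omega>. \<Prod>j\<in>J. e n j \<omega>) * (\<Prod>k\<in>insert k A. expectation (e n k)))) \<le>
        R n + real n * norm (expectation (P n) - Q n)"
        unfolding full Qk using bound[of n] by (simp add: distrib_left)
    qed
  qed
qed

lemma chf_clt:
  fixes X :: "'a \<Rightarrow> real"
  assumes X [measurable]: "X \<in> borel_measurable M" and X2: "integrable M (\<lambda>\<omega>. (X \<omega>)\<^sup>2)"
  shows "(\<lambda>n. cis (- (sqrt (real n) * expectation X)) * chf X (1 / sqrt (real n)) ^ n)
    \<longlonglongrightarrow> complex_of_real (exp (- variance X / 2))"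
proof -
  define \<mu> where "\<mu> = expectation X"
  define v where "v = variance X"
  define Y where "Y \<omega> = X \<omega> - \<mu>" for \<omega>
  have [measurable]: "Y \<in> borel_measurable M" unfolding Y_def by measurable
  have X1: "integrable M X" by (rule square_integrable_imp_integrable[OF X X2])
  have Y1: "integrable M Y" "expectation Y = 0"
    unfolding Y_def using X1 by (auto simp: prob_space \<mu>_def)
  have Y2: "integrable M (\<lambda>\<omega>. (Y \<omega>)\<^sup>2)"
    unfolding Y_def power2_diff using X1 X2 by simp
  have vY: "variance Y = v" using Y1(2) by (simp add: v_def Y_def \<mu>_def)
  have v0: "v \<ge> 0" unfolding v_def by (rule Bochner_Integration.integral_nonneg) simp
  define \<psi> where "\<psi> n = chf Y (1 / sqrt (real n))" for n
  have phase: "cis (- (sqrt (real n) * \<mu>)) * chf X (1 / sqrt (real n)) ^ n = \<psi> n ^ n" if "n \<ge> 1" for n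
  proof -
    have "chf Y \<tau> = cis (- (\<tau> * \<mu>)) * chf X \<tau>" for \<tau>
    proof -
      have "cis (\<tau> * Y \<omega>) = cis (- (\<tau> * \<mu>)) * cis (\<tau> * X \<omega>)" for \<omega>
        by (simp add: cis_mult Y_def algebra_simps)
      then show ?thesis by (simp add: mchar_distr)
    qed
    then have "\<psi> n ^ n = cis (- (1 / sqrt (real n) * \<mu>)) ^ n * chf X (1 / sqrt (real n)) ^ n"
      by (simp add: \<psi>_def power_mult_distrib)
    also have "cis (- (1 / sqrt (real n) * \<mu>)) ^ n = cis (real n * (- (1 / sqrt (real n) * \<mu>)))"
      by (rule Complex.DeMoivre)
    also have "real n * (- (1 / sqrt (real n) * \<mu>)) = - (sqrt (real n) * \<mu>)"
      using that by (simp add: field_simps)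
    finally show ?thesis by simp
  qed
  \<comment> \<open>This is the remainder of the second-order expansion of the characteristic
    function. The minimum gives both pointwise convergence to 0 and the integrable majorant
    \<open>6 * Y^2\<close>.\<close>
  define h where "h n = expectation (\<lambda>\<omega>. min (6 * (Y \<omega>)\<^sup>2) (\<bar>1 / sqrt (real n)\<bar> * \<bar>Y \<omega>\<bar> ^ 3))" for n
  have "h \<longlonglongrightarrow> expectation (\<lambda>\<omega>. 0)"
    unfolding h_def
  proof (rule integral_dominated_convergence[where w="\<lambda>\<omega>. 6 * (Y \<omega>)\<^sup>2"])
    have inv0: "(\<lambda>n. 1 / sqrt (real n)) \<longlonglongrightarrow> 0"
      by (intro tendsto_divide_0[OF tendsto_const] filterlim_at_top_imp_at_infinity
          filterlim_compose[OF sqrt_at_top] filterlim_real_sequentially)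
    show "AE \<omega> in M. (\<lambda>n. min (6 * (Y \<omega>)\<^sup>2) (\<bar>1 / sqrt (real n)\<bar> * \<bar>Y \<omega>\<bar> ^ 3)) \<longlonglongrightarrow> 0"
    proof (rule AE_I2)
      fix \<omega>
      have "(\<lambda>n. min (6 * (Y \<omega>)\<^sup>2) (\<bar>1 / sqrt (real n)\<bar> * \<bar>Y \<omega>\<bar> ^ 3)) \<longlonglongrightarrow>
        min (6 * (Y \<omega>)\<^sup>2) (\<bar>0\<bar> * \<bar>Y \<omega>\<bar> ^ 3)"
        by (intro tendsto_intros inv0)
      then show "(\<lambda>n. min (6 * (Y \<omega>)\<^sup>2) (\<bar>1 / sqrt (real n)\<bar> * \<bar>Y \<omega>\<bar> ^ 3)) \<longlonglongrightarrow> 0"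
        by simp
    qed
  qed (use Y2 in auto)
  then have h: "(\<lambda>n. h n / 6) \<longlonglongrightarrow> 0" using tendsto_divide_zero by auto
  have "(\<lambda>n. \<psi> n ^ n - complex_of_real ((1 + (- v / 2) / real n) ^ n)) \<longlonglongrightarrow> 0"
  proof (rule Lim_null_comparison[OF _ h])
    \<comment> \<open>From \<open>n \<ge> v\<close> on, \<open>1 - v / (2n)\<close> lies in the unit
      disc, as \<open>norm_power_diff\<close> demands.\<close>
    obtain N :: nat where N: "v \<le> real N" using real_arch_simple by blast
    have "eventually (\<lambda>n::nat. n \<ge> max 1 N) sequentially" by (rule eventually_ge_at_top)
    then show "eventually (\<lambda>n. norm (\<psi> n ^ n - complex_of_real ((1 + (- v / 2) / real n) ^ n)) \<le> h n / 6) sequentially"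
    proof eventually_elim
      case (elim n)
      then have n: "real n > 0" "v \<le> real n" using N by auto
      have "norm (\<psi> n ^ n - complex_of_real (1 + (- v / 2) / real n) ^ n) \<le>
        real n * norm (\<psi> n - complex_of_real (1 + (- v / 2) / real n))"
      proof (rule norm_power_diff)
        show "norm (\<psi> n) \<le> 1" unfolding \<psi>_def
          by (intro norm_mchar_le_1 borel_prob_distr prob_space_axioms) measurable
        have "\<bar>1 + (- v / 2) / real n\<bar> \<le> 1" using n v0 by (auto simp: abs_le_iff field_simps)
        then show "norm (complex_of_real (1 + (- v / 2) / real n)) \<le> 1" by (simp only: norm_of_real)
      qed
      also have "norm (\<psi> n - complex_of_real (1 + (- v / 2) / real n)) \<le> 1 / real n / 6 * h n"
      proof -
        have "norm (char (distr M borel Y) (1 / sqrt (real n)) - complex_of_real (1 - (1 / sqrt (real n))\<^sup>2 * v / 2)) \<le>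
          (1 / sqrt (real n))\<^sup>2 / 6 * h n"
          unfolding h_def using char_approx3'[OF _ Y1(1) Y2 Y1(2) vY refl, of "1 / sqrt (real n)"] by simp
        then show ?thesis using n by (simp add: char_eq_mchar \<psi>_def power_divide mult.commute)
      qed
      also have "real n * (1 / real n / 6 * h n) = h n / 6" using n by simp
      finally show ?case using n by (simp add: mult_left_mono)
    qed
  qed
  moreover have "(\<lambda>n. complex_of_real ((1 + (- v / 2) / real n) ^ n)) \<longlonglongrightarrow> complex_of_real (exp (- v / 2))"
    by (intro tendsto_of_real tendsto_exp_limit_sequentially)
  ultimately have "(\<lambda>n. \<psi> n ^ n) \<longlonglongrightarrow> complex_of_real (exp (- v / 2))"
    by (rule Lim_transform[rotated])
  then have "(\<lambda>n. cis (- (sqrt (real n) * \<mu>)) * chf X (1 / sqrt (real n)) ^ n) \<longlonglongrightarrow> complex_of_real (exp (- v / 2))"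
  proof (rule Lim_transform_eventually)
    have "eventually (\<lambda>n::nat. n \<ge> 1) sequentially" by (rule eventually_ge_at_top)
    then show "eventually (\<lambda>n. \<psi> n ^ n = cis (- (sqrt (real n) * \<mu>)) * chf X (1 / sqrt (real n)) ^ n) sequentially"
      by eventually_elim (simp add: phase)
  qed
  then show ?thesis by (simp add: \<mu>_def v_def)
qed

end

subsection \<open>Equivalence of the domains of attraction\<close>

context prob_space
begin

lemma DAN_imp_GDAN:
  fixes Z :: "'a \<Rightarrow> real ^ 'd"
  assumes Z [measurable]: "Z \<in> borel_measurable M"
    and cross: "\<And>j k. j \<noteq> k \<Longrightarrow>
           second_moment M (\<lambda>\<omega>. Z \<omega> $ j) = \<infinity> \<or> second_moment M (\<lambda>\<omega>. Z \<omega> $ k) = \<infinity> \<Longrightarrow>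
           (\<integral>\<^sup>+ \<omega>. ennreal \<bar>Z \<omega> $ j * Z \<omega> $ k\<bar> \<partial>M) < \<infinity>"
    and full: "full M {j. second_moment M (\<lambda>\<omega>. Z \<omega> $ j) < \<infinity>} (\<lambda>\<omega> j. Z \<omega> $ j)"
    and dan: "\<And>j. DAN M (\<lambda>\<omega>. Z \<omega> $ j)"
  shows "GDAN M Z"
proof -
  define J where "J = {j. second_moment M (\<lambda>\<omega>. Z \<omega> $ j) < \<infinity>}"
  define C where "C j \<omega> = Z \<omega> $ j" for j \<omega>
  have C_meas [measurable]: "C j \<in> borel_measurable M" for j unfolding C_def by measurable
  have inf: "second_moment M (C k) = \<infinity>" if "k \<notin> J" for k
    using that by (auto simp: J_def C_def[abs_def] less_top[symmetric])
  have C2: "integrable M (\<lambda>\<omega>. (C j \<omega>)\<^sup>2)" if "j \<in> J" for j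
    using that by (intro integrableI_bounded) (auto simp: J_def C_def second_moment_def)
  have C1: "integrable M (C j)" if "j \<in> J" for j
    using square_integrable_imp_integrable[OF C_meas C2[OF that]] .
  have CC: "integrable M (\<lambda>\<omega>. C i \<omega> * C j \<omega>)" if "i \<in> J" "j \<in> J" for i j
  proof (rule Bochner_Integration.integrable_bound)
    show "integrable M (\<lambda>\<omega>. (C i \<omega>)\<^sup>2 + (C j \<omega>)\<^sup>2)" using C2 that by simp
    have "\<bar>x * y\<bar> \<le> x\<^sup>2 + y\<^sup>2" for x y :: real
    proof -
      have "2 * \<bar>x * y\<bar> \<le> x\<^sup>2 + y\<^sup>2"
        using sum_squares_bound[of "\<bar>x\<bar>" "\<bar>y\<bar>"] by (simp add: abs_mult)
      then show ?thesis using abs_ge_zero[of "x * y"] by linarith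
    qed
    then show "AE \<omega> in M. norm (C i \<omega> * C j \<omega>) \<le> norm ((C i \<omega>)\<^sup>2 + (C j \<omega>)\<^sup>2)" by simp
  qed simp
  have Ccross: "integrable M (\<lambda>\<omega>. C j \<omega> * C k \<omega>)" if "j \<noteq> k" "k \<notin> J" for j k
    using cross[OF that(1)] inf[OF that(2)] by (intro integrableI_bounded) (auto simp: C_def[abs_def])

  define \<mu> where "\<mu> j = expectation (C j)" for j
  define U where "U u \<omega> = (\<Sum>j\<in>J. u $ j * (C j \<omega> - \<mu> j))" for u :: "real^'d" and \<omega>
  have U_meas [measurable]: "U u \<in> borel_measurable M" for u unfolding U_def by measurable
  have UU: "integrable M (\<lambda>\<omega>. U u \<omega> * U w \<omega>)" for u w
  proof -
    have "integrable M (\<lambda>\<omega>. (C i \<omega> - \<mu> i) * (C j \<omega> - \<mu> j))" if "i \<in> J" "j \<in> J" for i j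
      using CC[OF that] C1[OF that(1)] C1[OF that(2)] by (simp add: algebra_simps)
    then have "integrable M (\<lambda>\<omega>. \<Sum>i\<in>J. \<Sum>j\<in>J. (u $ i * w $ j) * ((C i \<omega> - \<mu> i) * (C j \<omega> - \<mu> j)))"
      by (intro Bochner_Integration.integrable_sum integrable_mult_right)
    then show ?thesis by (simp add: U_def sum_product mult_ac)
  qed
  have U_add: "U (x + y) \<omega> = U x \<omega> + U y \<omega>" for x y \<omega>
    by (simp add: U_def distrib_right sum.distrib)
  have U_scale: "U (c *\<^sub>R x) \<omega> = c * U x \<omega>" for c x \<omega>
    by (simp add: U_def sum_distrib_left mult.assoc)
  \<comment> \<open>The covariance form of the limit: that of the block on \<open>J\<close>, and
    independent unit variances on the other coordinates.\<close>
  define \<beta> where "\<beta> u w = expectation (\<lambda>\<omega>. U u \<omega> * U w \<omega>) + (\<Sum>k\<in>- J. u $ k * w $ k)" for u w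
  have \<beta>_sym: "\<beta> x y = \<beta> y x" for x y by (simp add: \<beta>_def mult.commute)
  have lin: "linear (\<lambda>x. \<beta> x y)" for y
    by (rule linearI)
       (simp_all add: \<beta>_def U_add U_scale UU distrib_right sum.distrib mult.assoc sum_distrib_left distrib_left)
  then have \<beta>_bil: "bilinear \<beta>"
    unfolding bilinear_def using \<beta>_sym by simp
  have \<beta>_pos: "\<beta> x x > 0" if nonzero: "x \<noteq> 0" for x
  proof (rule ccontr)
    assume "\<not> \<beta> x x > 0"
    moreover have "expectation (\<lambda>\<omega>. U x \<omega> * U x \<omega>) \<ge> 0" "(\<Sum>k\<in>- J. x $ k * x $ k) \<ge> 0"
      by (auto intro!: Bochner_Integration.integral_nonneg sum_nonneg)
    ultimately have z: "expectation (\<lambda>\<omega>. U x \<omega> * U x \<omega>) = 0" "(\<Sum>k\<in>- J. x $ k * x $ k) = 0"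
      unfolding \<beta>_def by linarith+
    have "\<forall>k\<in>-J. x $ k * x $ k = 0"
      using z(2) by (subst (asm) sum_nonneg_eq_0_iff) auto
    then have x0: "x $ k = 0" if "k \<notin> J" for k using that by auto
    have ae: "AE \<omega> in M. U x \<omega> = 0"
      using z(1) integral_nonneg_eq_0_iff_AE[OF UU[of x x]] by simp
    \<comment> \<open>Here \<open>x\<close> is supported on \<open>J\<close> and its combination of
      the block is almost surely constant; dividing by \<open>c\<close> gives the unit vector to
      which fullness applies.\<close>
    define c where "c = L2_set (\<lambda>j. x $ j) J"
    obtain j where "x $ j \<noteq> 0" using nonzero by (auto simp: vec_eq_iff)
    with x0 have "j \<in> J" by auto
    then have "c \<noteq> 0" using \<open>x $ j \<noteq> 0\<close> by (auto simp: c_def L2_set_eq_0_iff)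
    moreover have "c \<ge> 0" unfolding c_def by (rule L2_set_nonneg)
    ultimately have c: "c > 0" by simp
    have "L2_set (\<lambda>j. inverse c * x $ j) J = 1"
      using c by (subst L2_set_right_distrib[symmetric]) (auto simp: c_def[symmetric])
    then have "\<not> degenerate M (\<lambda>\<omega>. \<Sum>j\<in>J. Z \<omega> $ j * (inverse c * x $ j))"
      using full unfolding full_def J_def[symmetric] by blast
    moreover have "degenerate M (\<lambda>\<omega>. \<Sum>j\<in>J. Z \<omega> $ j * (inverse c * x $ j))"
      unfolding degenerate_def
    proof (rule exI)
      show "AE \<omega> in M. (\<Sum>j\<in>J. Z \<omega> $ j * (inverse c * x $ j)) = inverse c * (\<Sum>j\<in>J. x $ j * \<mu> j)"
        using ae
      proof eventually_elim
        case (elim \<omega>)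
        then have "(\<Sum>j\<in>J. x $ j * C j \<omega>) = (\<Sum>j\<in>J. x $ j * \<mu> j)"
          by (simp add: U_def right_diff_distrib sum_subtractf)
        then show ?case by (simp add: C_def sum_distrib_left[symmetric] mult_ac)
      qed
    qed
    ultimately show False by contradiction
  qed
  obtain v :: "'d \<Rightarrow> real ^ 'd" where v: "\<And>i j. \<beta> (v i) (v j) = of_bool (i = j)"
    using exists_orthonormal_for_bilinear[OF \<beta>_bil \<beta>_sym \<beta>_pos] by blast

  define norming where "norming j a b \<longleftrightarrow> (\<forall>n. 0 < b n) \<and>
      (\<forall>(s :: nat \<Rightarrow> real) s' q. s \<longlonglongrightarrow> s' \<longrightarrow> strict_mono q \<longrightarrow>
      (\<lambda>k. cis (- (s k / b (q k) * a (q k))) * chf (C j) (s k / b (q k)) ^ q k)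
      \<longlonglongrightarrow> complex_of_real (exp (- s'\<^sup>2 / 2)))" for j a b
  have "\<exists>a b. norming j a b" for j
  proof -
    have "DAN M (C j)" using dan[of j] by (simp add: C_def[abs_def])
    then show ?thesis
    proof (rule DAND[OF prob_space_axioms C_meas])
      fix a b :: "nat \<Rightarrow> real"
      assume "\<And>n. 0 < b n"
        and "\<And>(s :: nat \<Rightarrow> real) s' q. s \<longlonglongrightarrow> s' \<Longrightarrow> strict_mono q \<Longrightarrow>
          (\<lambda>k. cis (- (s k / b (q k) * a (q k))) * chf (C j) (s k / b (q k)) ^ q k)
          \<longlonglongrightarrow> complex_of_real (exp (- s'\<^sup>2 / 2))"
      then have "norming j a b" unfolding norming_def by blast
      then show "\<exists>a b. norming j a b" by blast
    qed
  qed
  then obtain a b where norming: "\<And>j. norming j (a j) (b j)" by metis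
  have b: "0 < b j n" for j n using norming[of j] by (simp add: norming_def)
  have conv: "(\<lambda>k. cis (- (s k / b j (q k) * a j (q k))) * chf (C j) (s k / b j (q k)) ^ q k)
      \<longlonglongrightarrow> complex_of_real (exp (- s'\<^sup>2 / 2))"
    if "s \<longlonglongrightarrow> s'" "strict_mono q" for j s s' q
    using norming[of j] that unfolding norming_def by blast
  \<comment> \<open>At \<open>n = 0\<close> the value on \<open>J\<close> is 0, and division by it
    yields 0; only large \<open>n\<close> affect the limit.\<close>
  define \<sigma> where "\<sigma> j n = (if j \<in> J then sqrt (real n) else b j n)" for j n
  define m where "m n = (\<chi> j. if j \<in> J then real n * \<mu> j else a j n)" for n
  show ?thesis
  proof (rule GDANI[OF prob_space_axioms Z])
    fix t :: "real^'d"
    \<comment> \<open>The orthonormality of \<open>v\<close> gives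
      \<open>\<beta> w w = (norm t)^2\<close>, which is what turns the limit covariance into the
      identity. The matrix with rows \<open>v i\<close>, its columns divided by \<sigma>, carries
      \<open>t\<close> to \<open>w $ k / \<sigma> k n\<close>.\<close>
    define w where "w = (\<Sum>i\<in>UNIV. t $ i *\<^sub>R v i)"
    have wk: "w $ k = (\<Sum>i\<in>UNIV. t $ i * v i $ k)" for k by (simp add: w_def)
    have \<beta>w: "\<beta> w w = (norm t)\<^sup>2"
    proof -
      have "\<beta> w w = (\<Sum>(i,j)\<in>UNIV \<times> UNIV. \<beta> (t $ i *\<^sub>R v i) (t $ j *\<^sub>R v j))"
        unfolding w_def by (rule bilinear_sum[OF \<beta>_bil])
      also have "\<dots> = (\<Sum>i\<in>UNIV. \<Sum>j\<in>UNIV. t $ i * (t $ j * of_bool (i = j)))"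
        by (simp add: sum.cartesian_product bilinear_lmul[OF \<beta>_bil] bilinear_rmul[OF \<beta>_bil] v mult.left_commute)
      also have "\<dots> = (norm t)\<^sup>2"
        by (simp add: power2_norm_eq_inner inner_vec_def of_bool_def if_distrib sum.delta cong: if_cong)
      finally show ?thesis .
    qed
    define \<tau> where "\<tau> k n = w $ k / \<sigma> k n" for k n
    have tB: "t v* (\<chi> i k. v i $ k / \<sigma> k n) = (\<chi> k. \<tau> k n)" for n
      by (simp add: vec_eq_iff vector_matrix_mult_def \<tau>_def wk sum_divide_distrib mult.commute)
    define e where "e n k \<omega> = cis (\<tau> k n * C k \<omega>)" for n k \<omega>
    have e_meas: "e n k \<in> borel_measurable M" for n k unfolding e_def by measurable
    have e_unit: "norm (e n k \<omega>) = 1" for n k \<omega> by (simp add: e_def)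
    define d where "d n k \<omega> = norm (e n k \<omega> - 1)" for n k \<omega>
    have d_le: "d n k \<omega> \<le> \<bar>\<tau> k n\<bar> * \<bar>C k \<omega>\<bar>" for n k \<omega>
      using norm_cis_diff_le[of "\<tau> k n * C k \<omega>" 0] by (simp add: d_def e_def abs_mult)
    have d0: "d n k \<omega> \<ge> 0" for n k \<omega> by (simp add: d_def)
    have Ed0: "expectation (d n k) \<ge> 0" for n k by (rule Bochner_Integration.integral_nonneg) (rule d0)
    have d2: "d n k \<omega> \<le> 2" for n k \<omega>
      using norm_triangle_ineq4[of "e n k \<omega>" 1] by (simp add: d_def e_unit)
    have d_meas [measurable]: "d n k \<in> borel_measurable M" for n k
      unfolding d_def using e_meas by measurable
    have d_int: "integrable M (d n k)" for n k
      by (rule integrable_const_bound[where B=2]) (auto simp: d0 d2)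

    have small: "(\<lambda>n. sqrt (real n) * expectation (d n k)) \<longlonglongrightarrow> 0" if "k \<notin> J" for k
      using DAN_infinite_variance_cis[OF C_meas inf[OF that] b conv, of "w $ k"] that
      by (simp add: d_def[abs_def] e_def \<tau>_def \<sigma>_def)
    have ratio: "(\<lambda>n. sqrt (real n) / \<sigma> k n) \<longlonglongrightarrow> of_bool (k \<in> J)" for k
    proof (cases "k \<in> J")
      case True
      have "eventually (\<lambda>n::nat. n \<ge> 1) sequentially" by (rule eventually_ge_at_top)
      then have "eventually (\<lambda>n. sqrt (real n) / \<sigma> k n = 1) sequentially"
        by eventually_elim (simp add: \<sigma>_def True)
      then show ?thesis using True by (simp add: tendsto_eventually)
    next
      case False
      then show ?thesis
        using DAN_infinite_variance_norming[OF C_meas inf[OF False] b conv] by (simp add: \<sigma>_def)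
    qed
    \<comment> \<open>With \<open>|cis y - 1| \<le> |y|\<close> the mean is at most
      \<open>|\<tau> j n| * |\<tau> k n|\<close> times \<open>E |C j * C k|\<close>. Each \<tau>
      absorbs one \<open>sqrt n\<close>: the ratio for \<open>j\<close> stays bounded, and the one
      for \<open>k\<close> tends to 0.\<close>
    have cr: "(\<lambda>n. real n * expectation (\<lambda>\<omega>. d n j \<omega> * d n k \<omega>)) \<longlonglongrightarrow> 0" if "k \<notin> J" "j \<noteq> k" for j k
    proof (rule Lim_null_comparison)
      let ?E = "expectation (\<lambda>\<omega>. \<bar>C j \<omega> * C k \<omega>\<bar>)"
      have "(\<lambda>n. \<bar>w $ j\<bar> * \<bar>w $ k\<bar> * (\<bar>sqrt (real n) / \<sigma> j n\<bar> * \<bar>sqrt (real n) / \<sigma> k n\<bar>) * ?E) \<longlonglongrightarrow>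
        \<bar>w $ j\<bar> * \<bar>w $ k\<bar> * (\<bar>of_bool (j \<in> J)\<bar> * \<bar>of_bool (k \<in> J)\<bar>) * ?E"
        by (intro tendsto_intros ratio)
      then show "(\<lambda>n. \<bar>w $ j\<bar> * \<bar>w $ k\<bar> * (\<bar>sqrt (real n) / \<sigma> j n\<bar> * \<bar>sqrt (real n) / \<sigma> k n\<bar>) * ?E) \<longlonglongrightarrow> 0"
        using that by simp
      show "eventually (\<lambda>n. norm (real n * expectation (\<lambda>\<omega>. d n j \<omega> * d n k \<omega>)) \<le>
        \<bar>w $ j\<bar> * \<bar>w $ k\<bar> * (\<bar>sqrt (real n) / \<sigma> j n\<bar> * \<bar>sqrt (real n) / \<sigma> k n\<bar>) * ?E) sequentially"
      proof (rule always_eventually, rule allI)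
        fix n
        have dd0: "expectation (\<lambda>\<omega>. d n j \<omega> * d n k \<omega>) \<ge> 0"
          by (intro Bochner_Integration.integral_nonneg mult_nonneg_nonneg d0)
        have "d n j \<omega> * d n k \<omega> \<le> 2 * 2" for \<omega> by (intro mult_mono d2 d0) simp
        then have dd_int: "integrable M (\<lambda>\<omega>. d n j \<omega> * d n k \<omega>)"
          by (intro integrable_const_bound[where B="2 * 2"]) (auto simp: d0)
        have "expectation (\<lambda>\<omega>. d n j \<omega> * d n k \<omega>) \<le> expectation (\<lambda>\<omega>. (\<bar>\<tau> j n\<bar> * \<bar>\<tau> k n\<bar>) * \<bar>C j \<omega> * C k \<omega>\<bar>)"
        proof (rule integral_mono)
          fix \<omega>
          have "d n j \<omega> * d n k \<omega> \<le> (\<bar>\<tau> j n\<bar> * \<bar>C j \<omega>\<bar>) * (\<bar>\<tau> k n\<bar> * \<bar>C k \<omega>\<bar>)"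
            by (intro mult_mono d_le d0) auto
          then show "d n j \<omega> * d n k \<omega> \<le> (\<bar>\<tau> j n\<bar> * \<bar>\<tau> k n\<bar>) * \<bar>C j \<omega> * C k \<omega>\<bar>"
            by (simp add: abs_mult mult_ac)
        qed (use dd_int Ccross[OF that(2,1)] in auto)
        also have "\<dots> = \<bar>\<tau> j n\<bar> * \<bar>\<tau> k n\<bar> * ?E" by simp
        finally have "real n * expectation (\<lambda>\<omega>. d n j \<omega> * d n k \<omega>) \<le>
          (sqrt (real n) * sqrt (real n)) * (\<bar>\<tau> j n\<bar> * \<bar>\<tau> k n\<bar> * ?E)"
          by (simp add: mult_left_mono)
        also have "\<dots> = \<bar>w $ j\<bar> * \<bar>w $ k\<bar> * (\<bar>sqrt (real n) / \<sigma> j n\<bar> * \<bar>sqrt (real n) / \<sigma> k n\<bar>) * ?E"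
          by (simp only: \<tau>_def abs_divide) (simp add: mult_ac)
        finally show "norm (real n * expectation (\<lambda>\<omega>. d n j \<omega> * d n k \<omega>)) \<le>
          \<bar>w $ j\<bar> * \<bar>w $ k\<bar> * (\<bar>sqrt (real n) / \<sigma> j n\<bar> * \<bar>sqrt (real n) / \<sigma> k n\<bar>) * ?E"
          using dd0 by simp
      qed
    qed
    \<comment> \<open>One \<open>sqrt n\<close> goes to each mean. The mean for \<open>k\<close>
      then tends to 0, while the one for \<open>j\<close> is bounded by a first moment if
      \<open>j \<in> J\<close> and tends to 0 otherwise.\<close>
    have mn: "(\<lambda>n. real n * (expectation (d n j) * expectation (d n k))) \<longlonglongrightarrow> 0" if "k \<notin> J" for j k
    proof -
      have split: "real n * (expectation (d n j) * expectation (d n k)) =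
        (sqrt (real n) * expectation (d n j)) * (sqrt (real n) * expectation (d n k))" for n
        by (simp add: algebra_simps)
      show ?thesis
      proof (cases "j \<in> J")
        case True
        have bd: "sqrt (real n) * expectation (d n j) \<le> \<bar>w $ j\<bar> * expectation (\<lambda>\<omega>. \<bar>C j \<omega>\<bar>)" for n
        proof -
          have "expectation (d n j) \<le> expectation (\<lambda>\<omega>. \<bar>\<tau> j n\<bar> * \<bar>C j \<omega>\<bar>)"
            using C1[OF True] d_int d_le by (intro integral_mono) auto
          then have "sqrt (real n) * expectation (d n j) \<le> sqrt (real n) * (\<bar>\<tau> j n\<bar> * expectation (\<lambda>\<omega>. \<bar>C j \<omega>\<bar>))"
            by (simp add: mult_left_mono)
          also have "\<dots> = (sqrt (real n) / sqrt (real n)) * (\<bar>w $ j\<bar> * expectation (\<lambda>\<omega>. \<bar>C j \<omega>\<bar>))"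
            by (simp add: \<tau>_def \<sigma>_def True)
          \<comment> \<open>Only an inequality, because \<open>sqrt (real n) / sqrt (real n)\<close>
            is 0 at \<open>n = 0\<close>.\<close>
          also have "\<dots> \<le> 1 * (\<bar>w $ j\<bar> * expectation (\<lambda>\<omega>. \<bar>C j \<omega>\<bar>))"
            by (intro mult_right_mono mult_nonneg_nonneg Bochner_Integration.integral_nonneg) auto
          finally show ?thesis by simp
        qed
        have scaled0: "0 \<le> sqrt (real n) * expectation (d n i)" for n i by (simp add: Ed0)
        have "norm (real n * (expectation (d n j) * expectation (d n k))) \<le>
          (\<bar>w $ j\<bar> * expectation (\<lambda>\<omega>. \<bar>C j \<omega>\<bar>)) * (sqrt (real n) * expectation (d n k))" for n
          unfolding split real_norm_def abs_of_nonneg[OF mult_nonneg_nonneg[OF scaled0 scaled0]]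
          by (rule mult_right_mono[OF bd scaled0])
        then show ?thesis
          by (rule Lim_null_comparison[OF always_eventually[OF allI] tendsto_mult_right_zero[OF small[OF that]]])
      next
        case False
        show ?thesis unfolding split using tendsto_mult_zero[OF small[OF False] small[OF that]] .
      qed
    qed
    have factor: "(\<lambda>n. real n * norm (expectation (\<lambda>\<omega>. \<Prod>j\<in>J \<union> - J. e n j \<omega>) -
      expectation (\<lambda>\<omega>. \<Prod>j\<in>J. e n j \<omega>) * (\<Prod>k\<in>- J. expectation (e n k)))) \<longlonglongrightarrow> 0"
      using cr mn unfolding d_def[abs_def]
      by (intro expectation_prod_cis_factor e_meas e_unit) auto

    define Y where "Y \<omega> = (\<Sum>j\<in>J. w $ j * C j \<omega>)" for \<omega>
    have Y_meas [measurable]: "Y \<in> borel_measurable M" unfolding Y_def by measurable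
    have EY: "expectation Y = (\<Sum>j\<in>J. w $ j * \<mu> j)"
      unfolding Y_def \<mu>_def using C1 by simp
    have YU: "Y \<omega> - expectation Y = U w \<omega>" for \<omega>
      by (simp add: EY) (simp add: Y_def U_def right_diff_distrib sum_subtractf)
    have "w $ i * C i \<omega> * (w $ j * C j \<omega>) = w $ i * w $ j * (C i \<omega> * C j \<omega>)" for i j \<omega>
      by simp
    then have Y2: "integrable M (\<lambda>\<omega>. (Y \<omega>)\<^sup>2)"
      unfolding Y_def power2_eq_square sum_product
      by (simp only:) (intro Bochner_Integration.integrable_sum integrable_mult_right CC)
    have \<beta>Y: "\<beta> w w = variance Y + (\<Sum>k\<in>- J. (w $ k)\<^sup>2)"
      unfolding \<beta>_def YU by (simp add: power2_eq_square)
    have cis_sum: "cis (\<Sum>k\<in>A. g k) = (\<Prod>k\<in>A. cis (g k))" for A and g :: "'d \<Rightarrow> real"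
      using finite[of A] by (induction A rule: finite_induct) (auto simp: cis_mult[symmetric])
    define \<phi> where "\<phi> n = expectation (\<lambda>\<omega>. \<Prod>j\<in>UNIV. e n j \<omega>)" for n
    define \<theta> where "\<theta> n = chf Y (1 / sqrt (real n)) * (\<Prod>k\<in>- J. chf (C k) (w $ k / b k n))" for n
    define p where "p n = cis (- (\<Sum>k\<in>UNIV. \<tau> k n * m n $ k))" for n
    have \<phi>_eq: "\<phi> n = mchar (distr M borel Z) (\<chi> k. \<tau> k n)" for n
      by (simp add: \<phi>_def mchar_distr e_def C_def inner_vec_def cis_sum)
    have EJ: "expectation (\<lambda>\<omega>. \<Prod>j\<in>J. e n j \<omega>) = chf Y (1 / sqrt (real n))" for n
    proof -
      have "(\<Prod>j\<in>J. e n j \<omega>) = cis (1 / sqrt (real n) * Y \<omega>)" for \<omega>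
        by (simp add: e_def cis_sum[symmetric] Y_def \<tau>_def \<sigma>_def sum_divide_distrib)
      then show ?thesis by (simp add: mchar_distr)
    qed
    have Ee: "expectation (e n k) = chf (C k) (w $ k / b k n)" if "k \<in> - J" for n k
      using that by (simp add: mchar_distr e_def[abs_def] \<tau>_def \<sigma>_def)
    have diff: "(\<lambda>n. real n * norm (\<phi> n - \<theta> n)) \<longlonglongrightarrow> 0"
      using factor by (simp add: \<phi>_def \<theta>_def EJ Ee Compl_partition)
    have \<phi>1: "norm (\<phi> n) \<le> 1" for n
      unfolding \<phi>_eq by (intro norm_mchar_le_1 borel_prob_distr prob_space_axioms Z)
    have \<theta>1: "norm (\<theta> n) \<le> 1" for n
      unfolding \<theta>_def norm_mult prod_norm[symmetric]
      by (intro mult_le_one prod_le_1 prod_nonneg conjI ballI norm_mchar_le_1 borel_prob_distr prob_space_axioms) auto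
    \<comment> \<open>Here the \<open>o(1 / n)\<close> is spent: the phase has modulus one, and
      passing to \<open>n\<close>-th powers multiplies the error by at most
      \<open>n\<close>.\<close>
    have "(\<lambda>n. p n * \<phi> n ^ n - p n * \<theta> n ^ n) \<longlonglongrightarrow> 0"
    proof (rule Lim_null_comparison[OF always_eventually diff], rule allI)
      fix n
      have "norm (p n * \<phi> n ^ n - p n * \<theta> n ^ n) = norm (\<phi> n ^ n - \<theta> n ^ n)"
        by (simp add: right_diff_distrib[symmetric] norm_mult p_def)
      also have "\<dots> \<le> real n * norm (\<phi> n - \<theta> n)" by (rule norm_power_diff[OF \<phi>1 \<theta>1])
      finally show "norm (p n * \<phi> n ^ n - p n * \<theta> n ^ n) \<le> real n * norm (\<phi> n - \<theta> n)" .
    qed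
    moreover have "(\<lambda>n. p n * \<theta> n ^ n) \<longlonglongrightarrow> complex_of_real (exp (- (norm t)\<^sup>2 / 2))"
    proof -
      have split: "(\<Sum>k\<in>UNIV. \<tau> k n * m n $ k) = sqrt (real n) * expectation Y + (\<Sum>k\<in>- J. w $ k / b k n * a k n)" for n
      proof -
        have "(\<Sum>k\<in>UNIV. \<tau> k n * m n $ k) = (\<Sum>k\<in>J. \<tau> k n * m n $ k) + (\<Sum>k\<in>- J. \<tau> k n * m n $ k)"
          by (subst sum.union_disjoint[symmetric]) (auto simp: Compl_partition)
        also have "(\<Sum>k\<in>J. \<tau> k n * m n $ k) = (\<Sum>k\<in>J. sqrt (real n) * (w $ k * \<mu> k))"
        proof (rule sum.cong[OF refl])
          fix k assume "k \<in> J"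
          then have "\<tau> k n * m n $ k = (real n / sqrt (real n)) * (w $ k * \<mu> k)"
            by (simp add: \<tau>_def \<sigma>_def m_def)
          then show "\<tau> k n * m n $ k = sqrt (real n) * (w $ k * \<mu> k)" by (simp add: real_div_sqrt)
        qed
        also have "(\<Sum>k\<in>- J. \<tau> k n * m n $ k) = (\<Sum>k\<in>- J. w $ k / b k n * a k n)"
          by (rule sum.cong) (auto simp: \<tau>_def \<sigma>_def m_def)
        finally show ?thesis by (simp add: EY sum_distrib_left)
      qed
      \<comment> \<open>The phase is distributed over the factors, so that each becomes a separately
        centred and normed characteristic function with a known limit.\<close>
      have "p n * \<theta> n ^ n = (cis (- (sqrt (real n) * expectation Y)) * chf Y (1 / sqrt (real n)) ^ n) *
        (\<Prod>k\<in>- J. cis (- (w $ k / b k n * a k n)) * chf (C k) (w $ k / b k n) ^ n)" for n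
      proof -
        have "p n = cis (- (sqrt (real n) * expectation Y)) * (\<Prod>k\<in>- J. cis (- (w $ k / b k n * a k n)))"
          unfolding p_def split cis_sum[symmetric] by (simp add: cis_mult sum_negf)
        then show ?thesis
          by (simp add: \<theta>_def power_mult_distrib prod_power_distrib prod.distrib mult_ac)
      qed
      moreover have "(\<lambda>n. (cis (- (sqrt (real n) * expectation Y)) * chf Y (1 / sqrt (real n)) ^ n) *
        (\<Prod>k\<in>- J. cis (- (w $ k / b k n * a k n)) * chf (C k) (w $ k / b k n) ^ n)) \<longlonglongrightarrow>
        complex_of_real (exp (- variance Y / 2)) * (\<Prod>k\<in>- J. complex_of_real (exp (- (w $ k)\<^sup>2 / 2)))"
        by (intro tendsto_mult tendsto_prod chf_clt Y_meas Y2 conv[OF tendsto_const strict_mono_id, unfolded id_apply])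
      moreover have "complex_of_real (exp (- variance Y / 2)) * (\<Prod>k\<in>- J. complex_of_real (exp (- (w $ k)\<^sup>2 / 2))) =
        complex_of_real (exp (- (norm t)\<^sup>2 / 2))"
      proof -
        \<comment> \<open>The exponents add up to \<open>\<beta> w w\<close>, which is why \<beta>
          was given the identity outside \<open>J\<close>.\<close>
        have "exp (- variance Y / 2) * (\<Prod>k\<in>- J. exp (- (w $ k)\<^sup>2 / 2)) = exp (- \<beta> w w / 2)"
          unfolding \<beta>Y exp_sum[OF finite, symmetric] exp_add[symmetric]
          by (simp add: sum_negf sum_divide_distrib[symmetric] add_divide_distrib)
        then show ?thesis by (simp only: \<beta>w flip: of_real_prod of_real_mult)
      qed
      ultimately show ?thesis by simp
    qed
    ultimately have "(\<lambda>n. p n * \<phi> n ^ n) \<longlonglongrightarrow> complex_of_real (exp (- (norm t)\<^sup>2 / 2))"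
      by (rule Lim_transform[rotated])
    then show "(\<lambda>n. cis (- ((t v* (\<chi> i k. v i $ k / \<sigma> k n)) \<bullet> m n)) *
      mchar (distr M borel Z) (t v* (\<chi> i k. v i $ k / \<sigma> k n)) ^ n) \<longlonglongrightarrow> complex_of_real (exp (- (norm t)\<^sup>2 / 2))"
      unfolding tB by (simp add: p_def \<phi>_eq inner_vec_def)
  qed
qed

end

theorem theorem3p2:
  fixes M :: "'a measure" and Z :: "'a \<Rightarrow> real ^ 'd"
  assumes "prob_space M"
    and "Z \<in> borel_measurable M"
    and "\<And>j k. j \<noteq> k \<Longrightarrow>
           second_moment M (\<lambda>\<omega>. Z \<omega> $ j) = \<infinity> \<or> second_moment M (\<lambda>\<omega>. Z \<omega> $ k) = \<infinity> \<Longrightarrow>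
           (\<integral>\<^sup>+ \<omega>. ennreal \<bar>Z \<omega> $ j * Z \<omega> $ k\<bar> \<partial>M) < \<infinity>"
    and "full M {j. second_moment M (\<lambda>\<omega>. Z \<omega> $ j) < \<infinity>} (\<lambda>\<omega> j. Z \<omega> $ j)"
  shows "GDAN M Z \<longleftrightarrow> (\<forall>j. DAN M (\<lambda>\<omega>. Z \<omega> $ j))"
  using GDAN_imp_DAN[OF assms(1,2)] prob_space.DAN_imp_GDAN[OF assms] by blast

end
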